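(* Let $\mathbb{K}\in\{\mathbb{R},\mathbb{C}\}$, let $m,n,p$ be positive integers with $p\le\min(m,n)$, and let $\mathcal{E}=\mathbb{K}^{m\times p}\oplus\mathbb{K}^{p\times p}\oplus\mathbb{K}^{n\times p}$ and $\mathcal{M}=\mathrm{St}_{\mathbb{K},p,m}\times\mathrm{S}^+_{\mathbb{K},p}\times\mathrm{St}_{\mathbb{K},p,n}\subset\mathcal{E}$. Let $\alpha_0,\alpha_1,\gamma_0,\gamma_1,\beta$ be positive real numbers and set $\delta=\alpha_1+\gamma_1$. For $Y=(U,P,V)\in\mathcal{M}$ and $\omega=[\omega_U,\omega_P,\omega_V]\in\mathcal{E}$ define $$\mathsf{g}[\omega_U,\omega_P,\omega_V]=[\alpha_0\omega_U+(\alpha_1-\alpha_0)UU^{\mathfrak{t}}\omega_U,\ \beta P^{-1}\omega_PP^{-1},\ \gamma_0\omega_V+(\gamma_1-\gamma_0)VV^{\mathfrak{t}}\omega_V].$$ Then the following hold. (1) For every $Y\in\mathcal{M}$, $\mathsf{g}=\mathsf{g}_Y$ is a positive-definite operator on $\mathcal{E}$, so $\langle\omega,\mathsf{g}_Y\omega'\rangle_{\mathcal{E}}$ is an inner product on $\mathcal{E}$; these inner products induce a Riemannian metric on $\mathcal{M}$. (2) The projection $\Pi_{\mathsf{g}}$ from $\mathcal{E}$ onto the horizontal space $\mathcal{H}_Y$ at $Y=(U,P,V)$ (orthogonal with respect to $\mathsf{g}$) is given by $$\begin{aligned}\Pi_{\mathsf{g}}[\omega_U,\omega_P,\omega_V]=\big[&U\{-\gamma_1D^-+\delta^{-1}(P^{-1}D^+-D^+P^{-1})\}+\omega_U-UU^{\mathfrak{t}}\omega_U,\\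 &\beta^{-1}D^+,\\ &V\{\alpha_1D^-+\delta^{-1}(P^{-1}D^+-D^+P^{-1})\}+\omega_V-VV^{\mathfrak{t}}\omega_V\big],\end{aligned}$$ where $$D^-=\delta^{-1}\,\mathrm{skew}_{\mathfrak{t}}(V^{\mathfrak{t}}\omega_V-U^{\mathfrak{t}}\omega_U),$$ $$D^+=\mathcal{L}(P)^{-1}\,\mathrm{sym}_{\mathfrak{t}}\big(\beta^{-1}\omega_P+\alpha_1\delta^{-1}(U^{\mathfrak{t}}\omega_UP-PU^{\mathfrak{t}}\omega_U)+\gamma_1\delta^{-1}(V^{\mathfrak{t}}\omega_VP-PV^{\mathfrak{t}}\omega_V)\big).$$ (3) For tangent vectors $\xi=(\xi_U,\xi_P,\xi_V)$ and $\eta=(\eta_U,\eta_P,\eta_V)$ in $T_Y\mathcal{M}$, the Christoffel metric term $\mathrm{K}$ is $$\begin{aligned}\mathrm{K}(\eta,\xi)=\big[&(\alpha_1-\alpha_0)\big(U\,\mathrm{sym}_{\mathfrak{t}}(\eta_U^{\mathfrak{t}}\xi_U)-(\eta_U\xi_U^{\mathfrak{t}}+\xi_U\eta_U^{\mathfrak{t}})U\big),\\ &-\beta\,\mathrm{sym}_{\mathfrak{t}}(P^{-1}\eta_PP^{-1}\xi_PP^{-1}),\\ &(\gamma_1-\gamma_0)\big(V\,\mathrm{sym}_{\mathfrak{t}}(\eta_V^{\mathfrak{t}}\xi_V)-(\eta_V\xi_V^{\mathfrak{t}}+\xi_V\eta_V^{\mathfrak{t}})V\big)\big].\end{aligned}$$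 (4) For $\xi\in T_Y\mathcal{M}$ and fixed $\omega\in\mathcal{E}$, the directional derivative $(\mathrm{D}_\xi\Pi_{\mathsf{g}})\omega$ is obtained by differentiating the formula in (2) in $Y$ in the direction $\xi$, where the derivatives of $D^-$ and $D^+$ (with $\omega$ held constant) are $$\mathrm{D}_\xi D^-=\delta^{-1}\,\mathrm{skew}_{\mathfrak{t}}(\xi_V^{\mathfrak{t}}\omega_V-\xi_U^{\mathfrak{t}}\omega_U),$$ $$\begin{aligned}\mathrm{D}_\xi D^+=\mathcal{L}(P)^{-1}\big\{&\mathrm{D}_\xi\,\mathrm{sym}_{\mathfrak{t}}\big(\alpha_1\delta^{-1}(U^{\mathfrak{t}}\omega_UP-PU^{\mathfrak{t}}\omega_U)+\gamma_1\delta^{-1}(V^{\mathfrak{t}}\omega_VP-PV^{\mathfrak{t}}\omega_V)\big)\\ &-\delta^{-1}\big(\xi_PD^+P^{-1}+P^{-1}D^+\xi_P-PD^+P^{-1}\xi_PP^{-1}-P^{-1}\xi_PP^{-1}D^+P\big)\big\}.\end{aligned}$$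
   Context: Transpose: $\mathfrak{t}$ denotes the transpose $T$ if $\mathbb{K}=\mathbb{R}$ and the Hermitian transpose $H$ if $\mathbb{K}=\mathbb{C}$. For a square matrix $A$, $\mathrm{sym}_{\mathfrak{t}}A=\frac12(A+A^{\mathfrak{t}})$ and $\mathrm{skew}_{\mathfrak{t}}A=\frac12(A-A^{\mathfrak{t}})$. Manifolds: $\mathrm{St}_{\mathbb{K},p,m}=\{U\in\mathbb{K}^{m\times p}:U^{\mathfrak{t}}U=I_p\}$ and similarly $\mathrm{St}_{\mathbb{K},p,n}$ (Stiefel manifolds); $\mathrm{S}^+_{\mathbb{K},p}$ is the manifold of $P\in\mathbb{K}^{p\times p}$ with $P^{\mathfrak{t}}=P$ and positive eigenvalues. The tangent space $T_Y\mathcal{M}$ at $Y=(U,P,V)$ is the real subspace of $\mathcal{E}$ of all $(\eta_U,\eta_P,\eta_V)$ with $U^{\mathfrak{t}}\eta_U+\eta_U^{\mathfrak{t}}U=0$, $\eta_P^{\mathfrak{t}}=\eta_P$, $V^{\mathfrak{t}}\eta_V+\eta_V^{\mathfrak{t}}V=0$. Base inner product: $\mathcal{E}$ is viewed as a real vector space with $\langle\omega,\omega'\rangle_{\mathcal{E}}=\mathrm{Re}\,\mathrm{Tr}(\omega_U^{\mathfrak{t}}\omega'_U)+\mathrm{Re}\,\mathrm{Tr}(\omega_P^{\mathfrak{t}}\omega'_P)+\mathrm{Re}\,\mathrm{Tr}(\omega_V^{\mathfrak{t}}\omega'_V)$ (real part superfluous if $\mathbb{K}=\mathbb{R}$). Self-adjointness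 and positive-definiteness of $\mathsf{g}_Y$ are with respect to it. Group action and horizontal space: the group $\mathrm{U}_{\mathbb{K},p}=\{O\in\mathbb{K}^{p\times p}:O^{\mathfrak{t}}O=OO^{\mathfrak{t}}=I_p\}$ acts on $\mathcal{M}$ by $O\cdot(U,P,V)=(UO^{\mathfrak{t}},OPO^{\mathfrak{t}},VO^{\mathfrak{t}})$; the quotient $\mathcal{M}/\mathrm{U}_{\mathbb{K},p}$ is identified with the manifold of rank-$p$ matrices in $\mathbb{K}^{m\times n}$ via $(U,P,V)\mapsto UPV^{\mathfrak{t}}$. The horizontal space $\mathcal{H}_Y$ is the subspace of $T_Y\mathcal{M}$ of vectors orthogonal, in the inner product $\langle\cdot,\mathsf{g}_Y\,\cdot\rangle_{\mathcal{E}}$, to the tangent space at $Y$ of the $\mathrm{U}_{\mathbb{K},p}$-orbit through $Y$. If $\mathrm{N}$ is a one-to-one linear operator into $\mathcal{E}$ with range exactly $\mathcal{H}_Y$, and $\mathrm{N}^{\mathfrak{t}}$ is its adjoint, then $\Pi_{\mathsf{g}}=\mathrm{N}(\mathrm{N}^{\mathfrak{t}}\mathsf{g}\mathrm{N})^{-1}\mathrm{N}^{\mathfrak{t}}\mathsf{g}$. Operator $\mathcal{L}(P)$: for $P\in\mathrm{S}^+_{\mathbb{K},p}$, $\mathcal{L}(P)X=(\beta^{-1}-2\delta^{-1})X+\delta^{-1}(P^{-1}XP+PXP^{-1})$ for $X\in\mathbb{K}^{p\times p}$. It is invertible: if $P=C\Lambda C^{\mathfrak{t}}$ with $C\in\mathrm{U}_{\mathbb{K},p}$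 and $\Lambda=\mathrm{diag}(\Lambda_1,\dots,\Lambda_p)$, then $\mathcal{L}(P)^{-1}Z=C\{(C^{\mathfrak{t}}ZC)/M\}C^{\mathfrak{t}}$, where $/$ is entrywise division and $M_{ij}=\beta^{-1}-2\delta^{-1}+\delta^{-1}(\Lambda_i^{-1}\Lambda_j+\Lambda_i\Lambda_j^{-1})>0$. Derivatives and Christoffel metric term: $\mathrm{D}_\xi$ is the directional derivative in the direction $\xi$ with respect to the point $Y=(U,P,V)$, so $\mathrm{D}_\xi U=\xi_U$, $\mathrm{D}_\xi P=\xi_P$, $\mathrm{D}_\xi V=\xi_V$. For the derivative $\mathrm{D}_\phi\mathsf{g}$ in arbitrary ambient directions $\phi\in\mathcal{E}$, $\mathsf{g}$ is extended by the same formula to all $(U,P,V)\in\mathcal{E}$ with $P$ invertible. The Christoffel metric term is, for $\xi,\eta\in T_Y\mathcal{M}$, $$\mathrm{K}(\xi,\eta)=\tfrac12\big((\mathrm{D}_\xi\mathsf{g})\eta+(\mathrm{D}_\eta\mathsf{g})\xi-\mathcal{X}(\xi,\eta)\big),$$ where $\mathcal{X}(\xi,\eta)\in\mathcal{E}$ is the unique element with $\langle\mathcal{X}(\xi,\eta),\phi\rangle_{\mathcal{E}}=\langle(\mathrm{D}_\phi\mathsf{g})\xi,\eta\rangle_{\mathcal{E}}$ for all $\phi\in\mathcal{E}$.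
   Formalization: In the formula for D^+ in (2), also used in (4), the term β^{-1}ω_P is replaced by ω_P; as printed the projection formula fails for β≠1 (e.g. K=R, m=n=p=1, where Π_g[0,w,0] must be [0,w,0] but the formula gives [0,w/β,0]). *)

theory Defs
  imports "HOL-Analysis.Analysis"
begin

text \<open>
  A commutative finite-dimensional real division algebra with multiplicative norm is a copy of
  the reals or of the complex numbers, so the type class below has, up to isomorphism, exactly the
  two instances given here; a statement about all its instances is a statement about
  \<open>\<real>\<close> and about \<open>\<complex>\<close>.
\<close>

class real_or_complex = real_normed_field + euclidean_space +
  fixes kcnj :: "'a \<Rightarrow> 'a"
    and kre :: "'a \<Rightarrow> real"
  assumes kcnj_add: "kcnj (x + y) = kcnj x + kcnj y"
    and kcnj_mult: "kcnj (x * y) = kcnj x * kcnj y"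
    and kcnj_kcnj: "kcnj (kcnj x) = x"
    and add_kcnj: "x + kcnj x = scaleR (2 * kre x) 1"
    and inner_eq_kre: "inner x y = kre (kcnj x * y)"

instantiation real :: real_or_complex
begin
definition kcnj_real :: "real \<Rightarrow> real" where "kcnj_real x = x"
definition kre_real :: "real \<Rightarrow> real" where "kre_real x = x"
instance by standard (simp_all add: kcnj_real_def kre_real_def)
end

instantiation complex :: real_or_complex
begin
definition kcnj_complex :: "complex \<Rightarrow> complex" where "kcnj_complex x = cnj x"
definition kre_complex :: "complex \<Rightarrow> real" where "kre_complex x = Re x"
instance
  by standard (simp_all add: kcnj_complex_def kre_complex_def complex_add_cnj inner_complex_def scaleR_conv_of_real)
end

lemma kre_add: "kre (x + y) = kre x + kre (y::'a::real_or_complex)"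
proof -
  have "(2 * kre (x + y)) *\<^sub>R (1::'a) = (x + kcnj x) + (y + kcnj y)"
    by (simp only: add_kcnj[symmetric] kcnj_add ac_simps)
  also have "\<dots> = (2 * kre x + 2 * kre y) *\<^sub>R 1"
    by (simp only: add_kcnj scaleR_add_left)
  finally have "(2 * kre (x + y)) *\<^sub>R (1::'a) = (2 * kre x + 2 * kre y) *\<^sub>R 1" .
  then show ?thesis by (simp only: scaleR_cancel_right) simp
qed

lemma kre_0: "kre (0::'a::real_or_complex) = 0"
  using kre_add[of "0::'a" 0] by simp

lemma kre_sum: "kre (\<Sum>i\<in>A. f i) = (\<Sum>i\<in>A. kre (f i :: 'a::real_or_complex))"
  by (induction A rule: infinite_finite_induct) (simp_all add: kre_0 kre_add)

definition ktrans :: "'k::real_or_complex^'c^'r \<Rightarrow> 'k^'r^'c"  ("(_\<^sup>\<dagger>)" [1000] 999)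
  where "A\<^sup>\<dagger> = (\<chi> i j. kcnj (A $ j $ i))"

definition sym_t :: "'k::real_or_complex^'p^'p \<Rightarrow> 'k^'p^'p"
  where "sym_t A = (1/2) *\<^sub>R (A + A\<^sup>\<dagger>)"

definition skew_t :: "'k::real_or_complex^'p^'p \<Rightarrow> 'k^'p^'p"
  where "skew_t A = (1/2) *\<^sub>R (A - A\<^sup>\<dagger>)"

definition is_eigenvalue :: "'k::real_or_complex^'p^'p \<Rightarrow> 'k \<Rightarrow> bool"
  where "is_eigenvalue A c \<longleftrightarrow> (\<exists>x. x \<noteq> 0 \<and> A *v x = c *s x)"

definition stiefel :: "('k::real_or_complex^'p^'m) set"
  where "stiefel = {U. U\<^sup>\<dagger> ** U = mat 1}"

text \<open>
  A real symmetric matrix has only real eigenvalues, so that looking at eigenvalues in the scalar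
  field itself loses nothing.
\<close>

definition pos_def_matrices :: "('k::real_or_complex^'p^'p) set"
  where "pos_def_matrices =
    {P. P\<^sup>\<dagger> = P \<and> (\<forall>c. is_eigenvalue P c \<longrightarrow> (\<exists>r>0. c = of_real r))}"

definition unitary_matrices :: "('k::real_or_complex^'p^'p) set"
  where "unitary_matrices = {Q. Q\<^sup>\<dagger> ** Q = mat 1 \<and> Q ** Q\<^sup>\<dagger> = mat 1}"

text \<open>\<open>'k^'p^'m\<close> is the type of matrices with rows indexed by \<open>'m\<close> and columns by \<open>'p\<close>.\<close>

type_synonym ('k, 'm, 'n, 'p) ambient = "('k^'p^'m) \<times> ('k^'p^'p) \<times> ('k^'p^'n)"
type_synonym ('k, 'm, 'n, 'p) operator = "('k, 'm, 'n, 'p) ambient \<Rightarrow> ('k, 'm, 'n, 'p) ambient"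
type_synonym ('k, 'm, 'n, 'p) operator_family =
  "('k, 'm, 'n, 'p) ambient \<Rightarrow> ('k, 'm, 'n, 'p) operator"

fun inner_E :: "('k::real_or_complex, 'm::finite, 'n::finite, 'p::finite) ambient \<Rightarrow> ('k, 'm, 'n, 'p) ambient \<Rightarrow> real"
  where "inner_E (aU, aP, aV) (bU, bP, bV) =
    kre (trace (aU\<^sup>\<dagger> ** bU)) + kre (trace (aP\<^sup>\<dagger> ** bP)) + kre (trace (aV\<^sup>\<dagger> ** bV))"

definition manif :: "('k::real_or_complex, 'm::finite, 'n::finite, 'p::finite) ambient set"
  where "manif = stiefel \<times> pos_def_matrices \<times> stiefel"

fun tangent_space :: "('k::real_or_complex, 'm::finite, 'n::finite, 'p::finite) ambient \<Rightarrow> ('k, 'm, 'n, 'p) ambient set"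
  where "tangent_space (U, P, V) = {(hU, hP, hV).
    U\<^sup>\<dagger> ** hU + hU\<^sup>\<dagger> ** U = 0 \<and> hP\<^sup>\<dagger> = hP \<and> V\<^sup>\<dagger> ** hV + hV\<^sup>\<dagger> ** V = 0}"

lemma kre_trace_eq_inner: "kre (trace (A\<^sup>\<dagger> ** B)) = inner A (B :: 'k::real_or_complex^'c^'r)"
proof -
  have "kre (trace (A\<^sup>\<dagger> ** B)) = (\<Sum>i\<in>UNIV. \<Sum>j\<in>UNIV. inner (A $ j $ i) (B $ j $ i))"
    by (simp add: trace_def matrix_matrix_mult_def ktrans_def kre_sum inner_eq_kre)
  also have "\<dots> = inner A B"
    by (subst sum.swap) (simp add: inner_vec_def)
  finally show ?thesis .
qed

lemma inner_E_eq_inner: "inner_E a b = inner a b"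
  by (cases a; cases b) (simp add: kre_trace_eq_inner)

definition pos_def_operator ::
    "('k::real_or_complex, 'm::finite, 'n::finite, 'p::finite) operator \<Rightarrow> bool"
  where "pos_def_operator G \<longleftrightarrow>
    linear G \<and> (\<forall>a b. inner_E (G a) b = inner_E a (G b)) \<and> (\<forall>a. a \<noteq> 0 \<longrightarrow> inner_E a (G a) > 0)"

definition inner_product_on :: "'a::real_vector set \<Rightarrow> ('a \<Rightarrow> 'a \<Rightarrow> real) \<Rightarrow> bool"
  where "inner_product_on S h \<longleftrightarrow>
    subspace S \<and>
    (\<forall>x\<in>S. \<forall>y\<in>S. \<forall>z\<in>S. \<forall>c. h (c *\<^sub>R x + y) z = c * h x z + h y z) \<and>
    (\<forall>x\<in>S. \<forall>y\<in>S. h x y = h y x) \<and>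
    (\<forall>x\<in>S. x \<noteq> 0 \<longrightarrow> h x x > 0)"

text \<open>Used only for open sets \<open>W\<close> of finite-dimensional spaces.\<close>

primrec Ck_on :: "nat \<Rightarrow> 'a::real_normed_vector set \<Rightarrow> ('a \<Rightarrow> 'b::real_normed_vector) \<Rightarrow> bool"
  where
    "Ck_on 0 W f \<longleftrightarrow> continuous_on W f"
  | "Ck_on (Suc k) W f \<longleftrightarrow>
      (\<forall>x\<in>W. f differentiable (at x)) \<and> (\<forall>v. Ck_on k W (\<lambda>x. frechet_derivative f (at x) v))"

definition smooth_on_open :: "'a::real_normed_vector set \<Rightarrow> ('a \<Rightarrow> 'b::real_normed_vector) \<Rightarrow> bool"
  where "smooth_on_open W f \<longleftrightarrow> (\<forall>k. Ck_on k W f)"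

text \<open>
  A Riemannian metric on a submanifold \<open>M\<close> of a Euclidean space, with tangent spaces \<open>T y\<close>: an inner
  product on each tangent space, depending smoothly on the point in the usual sense for
  submanifolds, i.e. locally it is the restriction of a smooth family of bilinear forms on the
  ambient space.
\<close>

definition riemannian_metric_on ::
    "'a::real_normed_vector set \<Rightarrow> ('a \<Rightarrow> 'a set) \<Rightarrow> ('a \<Rightarrow> 'a \<Rightarrow> 'a \<Rightarrow> real) \<Rightarrow> bool"
  where "riemannian_metric_on M T h \<longleftrightarrow>
    (\<forall>y\<in>M. inner_product_on (T y) (h y)) \<and>
    (\<forall>y\<in>M. \<exists>W G. open W \<and> y \<in> W \<and>
       (\<forall>z\<in>W. bilinear (G z)) \<and>
       (\<forall>a b. smooth_on_open W (\<lambda>z. G z a b)) \<and>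
       (\<forall>z\<in>M \<inter> W. \<forall>a\<in>T z. \<forall>b\<in>T z. G z a b = h z a b))"

fun act :: "'k::real_or_complex^'p^'p \<Rightarrow> ('k, 'm::finite, 'n::finite, 'p) ambient \<Rightarrow> ('k, 'm, 'n, 'p) ambient"
  where "act Q (U, P, V) = (U ** Q\<^sup>\<dagger>, Q ** P ** Q\<^sup>\<dagger>, V ** Q\<^sup>\<dagger>)"

definition orbit :: "('k::real_or_complex, 'm::finite, 'n::finite, 'p::finite) ambient \<Rightarrow> ('k, 'm, 'n, 'p) ambient set"
  where "orbit Y = {act Q Y | Q. Q \<in> unitary_matrices}"

text \<open>The tangent space of a submanifold, as the set of velocities of curves in it.\<close>

definition velocities :: "'a::real_normed_vector set \<Rightarrow> 'a \<Rightarrow> 'a set"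
  where "velocities S y =
    {v. \<exists>c. (\<forall>t. c t \<in> S) \<and> c 0 = y \<and> (c has_vector_derivative v) (at 0)}"

definition horizontal_space ::
    "('k::real_or_complex, 'm::finite, 'n::finite, 'p::finite) operator_family
      \<Rightarrow> ('k, 'm, 'n, 'p) ambient \<Rightarrow> ('k, 'm, 'n, 'p) ambient set"
  where "horizontal_space g Y =
    {h \<in> tangent_space Y. \<forall>v \<in> velocities (orbit Y) Y. inner_E v (g Y h) = 0}"

definition is_orth_proj ::
    "('k::real_or_complex, 'm::finite, 'n::finite, 'p::finite) operator
      \<Rightarrow> ('k, 'm, 'n, 'p) ambient set \<Rightarrow> ('k, 'm, 'n, 'p) ambient \<Rightarrow> ('k, 'm, 'n, 'p) ambient \<Rightarrow> bool"
  where "is_orth_proj G H w h \<longleftrightarrow> h \<in> H \<and> (\<forall>v\<in>H. inner_E v (G (w - h)) = 0)"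

definition orth_proj ::
    "('k::real_or_complex, 'm::finite, 'n::finite, 'p::finite) operator
      \<Rightarrow> ('k, 'm, 'n, 'p) ambient set \<Rightarrow> ('k, 'm, 'n, 'p) ambient \<Rightarrow> ('k, 'm, 'n, 'p) ambient"
  where "orth_proj G H w = (THE h. is_orth_proj G H w h)"

definition horizontal_proj ::
    "('k::real_or_complex, 'm::finite, 'n::finite, 'p::finite) operator_family
      \<Rightarrow> ('k, 'm, 'n, 'p) ambient \<Rightarrow> ('k, 'm, 'n, 'p) ambient \<Rightarrow> ('k, 'm, 'n, 'p) ambient"
  where "horizontal_proj g Y w = orth_proj (g Y) (horizontal_space g Y) w"

text \<open>
  The orthogonal projection onto the range of a one-to-one linear map \<open>N\<close> is
  \<open>N (N\<^sup>t G N)\<^sup>-\<^sup>1 N\<^sup>t G\<close>.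
\<close>

lemma orth_proj_param:
  fixes N :: "'h::euclidean_space \<Rightarrow> ('k::real_or_complex, 'm::finite, 'n::finite, 'p::finite) ambient"
  assumes N: "linear N" "inj N" and G: "pos_def_operator G"
  defines "A \<equiv> adjoint N \<circ> G \<circ> N"
  shows "bij A"
    and "is_orth_proj G (range N) w (N (inv A (adjoint N (G w))))"
    and "orth_proj G (range N) w = N (inv A (adjoint N (G w)))"
proof -
  have linG: "linear G" and pos: "\<And>a. a \<noteq> 0 \<Longrightarrow> inner a (G a) > 0"
    using G by (auto simp: pos_def_operator_def inner_E_eq_inner)
  have adj: "inner x (adjoint N y) = inner (N x) y" for x y
    by (rule adjoint_works[OF N(1)])
  have linA: "linear A"
    unfolding A_def by (intro linear_compose N linG adjoint_linear)
  have "inj A"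
  proof (subst linear_injective_0[OF linA], intro allI impI)
    fix x assume "A x = 0"
    then have "inner (N x) (G (N x)) = 0"
      using adj[of x "G (N x)"] by (simp add: A_def)
    then have "N x = 0" using pos[of "N x"] by fastforce
    then show "x = 0" using N linear_injective_0 by blast
  qed
  then show "bij A"
    using linA linear_injective_imp_surjective by (auto simp: bij_def)
  show ex: "is_orth_proj G (range N) w (N (inv A (adjoint N (G w))))"
    unfolding is_orth_proj_def inner_E_eq_inner
  proof (intro conjI ballI)
    fix v assume "v \<in> range N"
    then obtain x where v: "v = N x" by blast
    have "A (inv A (adjoint N (G w))) = adjoint N (G w)"
      using \<open>bij A\<close> by (simp add: bij_def surj_f_inv_f)
    then have "inner x (adjoint N (G (N (inv A (adjoint N (G w)))))) = inner x (adjoint N (G w))"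
      by (simp add: A_def)
    then show "inner v (G (w - N (inv A (adjoint N (G w))))) = 0"
      by (simp add: v adj linear_diff[OF linG] inner_diff_right)
  qed simp
  have uniq: "h = h'" if "is_orth_proj G (range N) w h" "is_orth_proj G (range N) w h'" for h h'
  proof -
    from that have "h - h' \<in> range N"
      using linear_diff[OF N(1)] by (auto simp: is_orth_proj_def simp flip: linear_diff[OF N(1)])
    with that have "inner (h - h') (G (w - h')) = 0" "inner (h - h') (G (w - h)) = 0"
      by (auto simp: is_orth_proj_def inner_E_eq_inner)
    then have "inner (h - h') (G (h - h')) = 0"
      by (simp add: linear_diff[OF linG] inner_diff_right)
    then show ?thesis using pos[of "h - h'"] by fastforce
  qed
  show "orth_proj G (range N) w = N (inv A (adjoint N (G w)))"
    unfolding orth_proj_def using ex uniq by blast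
qed

text \<open>
  These are functions on the whole ambient space, as needed to differentiate them; they are
  meaningful near every point with \<open>P\<close> positive definite.
\<close>

fun metric_op :: "real \<Rightarrow> real \<Rightarrow> real \<Rightarrow> real \<Rightarrow> real \<Rightarrow>
    ('k::real_or_complex, 'm::finite, 'n::finite, 'p::finite) ambient \<Rightarrow> ('k, 'm, 'n, 'p) ambient \<Rightarrow> ('k, 'm, 'n, 'p) ambient"
  where "metric_op \<alpha>0 \<alpha>1 \<gamma>0 \<gamma>1 \<beta> (U, P, V) (wU, wP, wV) =
    (\<alpha>0 *\<^sub>R wU + (\<alpha>1 - \<alpha>0) *\<^sub>R (U ** U\<^sup>\<dagger> ** wU),
     \<beta> *\<^sub>R (matrix_inv P ** wP ** matrix_inv P),
     \<gamma>0 *\<^sub>R wV + (\<gamma>1 - \<gamma>0) *\<^sub>R (V ** V\<^sup>\<dagger> ** wV))"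

definition L_op :: "real \<Rightarrow> real \<Rightarrow> 'k::real_or_complex^'p^'p \<Rightarrow> 'k^'p^'p \<Rightarrow> 'k^'p^'p"
  where "L_op \<beta> \<delta> P X =
    (1/\<beta> - 2/\<delta>) *\<^sub>R X + (1/\<delta>) *\<^sub>R (matrix_inv P ** X ** P + P ** X ** matrix_inv P)"

fun D_minus :: "real \<Rightarrow> ('k::real_or_complex, 'm::finite, 'n::finite, 'p::finite) ambient \<Rightarrow> ('k, 'm, 'n, 'p) ambient \<Rightarrow> 'k^'p^'p"
  where "D_minus \<delta> (U, P, V) (wU, wP, wV) = (1/\<delta>) *\<^sub>R skew_t (V\<^sup>\<dagger> ** wV - U\<^sup>\<dagger> ** wU)"

fun D_plus_arg :: "real \<Rightarrow> real \<Rightarrow> real \<Rightarrow>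
    ('k::real_or_complex, 'm::finite, 'n::finite, 'p::finite) ambient \<Rightarrow> ('k, 'm, 'n, 'p) ambient \<Rightarrow> 'k^'p^'p"
  where "D_plus_arg \<alpha>1 \<gamma>1 \<delta> (U, P, V) (wU, wP, wV) =
    (\<alpha>1/\<delta>) *\<^sub>R (U\<^sup>\<dagger> ** wU ** P - P ** U\<^sup>\<dagger> ** wU) + (\<gamma>1/\<delta>) *\<^sub>R (V\<^sup>\<dagger> ** wV ** P - P ** V\<^sup>\<dagger> ** wV)"

text \<open>
  The coefficient of \<open>wP\<close> has to be 1. With the coefficient \<open>1/\<beta>\<close> instead, the map
  \<open>proj_formula\<close> below would not be the projection unless \<open>\<beta> = 1\<close>: for real 1-by-1 matrices the
  orbits are discrete, so the projection fixes \<open>(0, wP, 0)\<close>, whereas \<open>(1/\<beta>) *\<^sub>R D_plus\<close> would be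
  \<open>(1/\<beta>) *\<^sub>R wP\<close>.
\<close>

fun D_plus :: "real \<Rightarrow> real \<Rightarrow> real \<Rightarrow> real \<Rightarrow>
    ('k::real_or_complex, 'm::finite, 'n::finite, 'p::finite) ambient \<Rightarrow> ('k, 'm, 'n, 'p) ambient \<Rightarrow> 'k^'p^'p"
  where "D_plus \<alpha>1 \<gamma>1 \<beta> \<delta> (U, P, V) (wU, wP, wV) =
    inv (L_op \<beta> \<delta> P) (sym_t (wP + D_plus_arg \<alpha>1 \<gamma>1 \<delta> (U, P, V) (wU, wP, wV)))"

fun proj_formula :: "real \<Rightarrow> real \<Rightarrow> real \<Rightarrow> real \<Rightarrow>
    ('k::real_or_complex, 'm::finite, 'n::finite, 'p::finite) ambient \<Rightarrow> ('k, 'm, 'n, 'p) ambient \<Rightarrow> ('k, 'm, 'n, 'p) ambient"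
  where "proj_formula \<alpha>1 \<gamma>1 \<beta> \<delta> (U, P, V) (wU, wP, wV) =
   (let Dm = D_minus \<delta> (U, P, V) (wU, wP, wV);
        Dp = D_plus \<alpha>1 \<gamma>1 \<beta> \<delta> (U, P, V) (wU, wP, wV);
        Pi = matrix_inv P
    in (U ** (- \<gamma>1 *\<^sub>R Dm + (1/\<delta>) *\<^sub>R (Pi ** Dp - Dp ** Pi)) + wU - U ** U\<^sup>\<dagger> ** wU,
        (1/\<beta>) *\<^sub>R Dp,
        V ** (\<alpha>1 *\<^sub>R Dm + (1/\<delta>) *\<^sub>R (Pi ** Dp - Dp ** Pi)) + wV - V ** V\<^sup>\<dagger> ** wV))"

text \<open>
  \<open>dirderiv F Y v\<close> is a derivative only if \<open>F\<close> is differentiable at \<open>Y\<close>. The derivative of an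
  operator \<open>g\<close> depending on \<open>Y\<close>, applied to a fixed vector \<open>w\<close>, is \<open>dirderiv (\<lambda>Z. g Z w) Y v\<close>.
\<close>

definition dirderiv :: "('a::real_normed_vector \<Rightarrow> 'b::real_normed_vector) \<Rightarrow> 'a \<Rightarrow> 'a \<Rightarrow> 'b"
  where "dirderiv F Y v = frechet_derivative F (at Y) v"

definition is_cross_term ::
    "('k::real_or_complex, 'm::finite, 'n::finite, 'p::finite) operator_family
      \<Rightarrow> ('k, 'm, 'n, 'p) ambient \<Rightarrow> ('k, 'm, 'n, 'p) ambient \<Rightarrow> ('k, 'm, 'n, 'p) ambient
      \<Rightarrow> ('k, 'm, 'n, 'p) ambient \<Rightarrow> bool"
  where "is_cross_term g Y \<xi> \<eta> x \<longleftrightarrow>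
    (\<forall>\<phi>. inner_E x \<phi> = inner_E (dirderiv (\<lambda>Z. g Z \<xi>) Y \<phi>) \<eta>)"

definition christoffel ::
    "('k::real_or_complex, 'm::finite, 'n::finite, 'p::finite) operator_family
      \<Rightarrow> ('k, 'm, 'n, 'p) ambient \<Rightarrow> ('k, 'm, 'n, 'p) ambient \<Rightarrow> ('k, 'm, 'n, 'p) ambient
      \<Rightarrow> ('k, 'm, 'n, 'p) ambient"
  where "christoffel g Y \<xi> \<eta> =
    (1/2) *\<^sub>R (dirderiv (\<lambda>Z. g Z \<eta>) Y \<xi> + dirderiv (\<lambda>Z. g Z \<xi>) Y \<eta>
               - (THE x. is_cross_term g Y \<xi> \<eta> x))"

end

theory Submission
  imports Defs
begin

text \<open>
  Everything is an identity between real inner products of matrices, evaluated by moving factors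
  across the inner product with the conjugate transpose, except for three facts that need an
  argument.

  The first one is positivity. The hypothesis on \<open>P\<close> is about its eigenvalues in the scalar field,
  while the metric and \<open>L_op\<close> need positivity of operators such as \<open>X \<mapsto> P X P\<^sup>-\<^sup>1\<close>. A self-adjoint
  operator on a Euclidean space attains the minimum of its quadratic form at an eigenvector, so
  multiplication by \<open>P\<close> from either side is a positive operator, and products of commuting positive
  operators are positive because they have common eigenvectors (\<open>positive_op_compose\<close>). Then
  \<open>A X = P X P\<^sup>-\<^sup>1\<close> is positive and \<open>A - 2 + A\<^sup>-\<^sup>1\<close> is nonnegative, which makes \<open>L_op\<close> invertible
  (\<open>positive_op_L_op\<close>).

  The second one is the horizontal space. Cayley transforms realise every skew matrix \<open>a\<close> as a
  velocity in the unitary group, so the tangent space of the orbit consists of all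
  \<open>(- U a, a P - P a, - V a)\<close> (\<open>velocities_orbit\<close>). Hence a tangent vector \<open>h\<close> is horizontal if and only if
  \<open>\<alpha>1 U\<^sup>\<dagger> h\<^sub>U + \<gamma>1 V\<^sup>\<dagger> h\<^sub>V = \<beta> (P\<^sup>-\<^sup>1 h\<^sub>P - h\<^sub>P P\<^sup>-\<^sup>1)\<close> (\<open>horizontal_space_iff\<close>). The formula for the
  projection satisfies this equation, and its residual is orthogonal to all its solutions exactly
  because of the equations that define \<open>D_minus\<close> and \<open>D_plus\<close> (\<open>is_orth_proj_proj_formula\<close>).

  The third one is differentiability of the matrix inverse and of \<open>D_plus\<close>, which are both solutions
  \<open>u\<close> of a linear system \<open>A z (u z) = b z\<close> with parameter \<open>z\<close>. Such a solution is differentiable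
  wherever \<open>A z\<close> is bijective, and its derivative results from differentiating the equation
  (\<open>has_derivative_linear_system\<close>). This gives the derivatives of the projection, and of the metric, from
  which the Christoffel term is computed with the tangency relations \<open>U\<^sup>\<dagger> x = - x\<^sup>\<dagger> U\<close>. The same
  formula for the derivative of the inverse shows inductively that the metric is smooth.
\<close>

section \<open>Conjugation and the conjugate transpose\<close>

lemma kcnj_one: "kcnj (1::'k::real_or_complex) = 1"
proof -
  have "kcnj (1::'k) \<noteq> 0"
    by (metis kcnj_kcnj kcnj_add add_cancel_left_right zero_neq_one)
  then show ?thesis
    using kcnj_mult[of "1::'k" 1] by simp
qed

lemma kre_eq_inner: "kre x = inner 1 (x::'k::real_or_complex)"
  by (simp add: inner_eq_kre kcnj_one)

lemma kcnj_eq: "kcnj x = (2 * inner 1 x) *\<^sub>R 1 - (x::'k::real_or_complex)"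
  using add_kcnj[of x] by (simp add: kre_eq_inner algebra_simps)

lemma bounded_linear_kcnj: "bounded_linear (kcnj :: 'k::real_or_complex \<Rightarrow> 'k)"
  unfolding kcnj_eq[abs_def]
  by (intro bounded_linear_sub bounded_linear_scaleR_const bounded_linear_ident
      bounded_linear_mult_const bounded_linear_const_mult bounded_linear_inner_right)

lemmas kcnj_scaleR = linear_scale[OF bounded_linear.linear[OF bounded_linear_kcnj]]
lemmas kcnj_zero = linear_0[OF bounded_linear.linear[OF bounded_linear_kcnj]]
lemmas kcnj_sum = linear_sum[OF bounded_linear.linear[OF bounded_linear_kcnj]]

lemma ktrans_ktrans [simp]: "(A\<^sup>\<dagger>)\<^sup>\<dagger> = (A::'k::real_or_complex^'c^'r)"
  by (simp add: ktrans_def vec_eq_iff kcnj_kcnj)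

lemma ktrans_mult [simp]: "(A ** B)\<^sup>\<dagger> = B\<^sup>\<dagger> ** (A::'k::real_or_complex^'c^'r)\<^sup>\<dagger>"
  by (simp add: ktrans_def vec_eq_iff matrix_matrix_mult_def kcnj_sum kcnj_mult mult.commute)

lemma linear_ktrans: "linear (ktrans :: 'k::real_or_complex^'c^'r \<Rightarrow> 'k^'r^'c)"
  by (rule linearI) (simp_all add: ktrans_def vec_eq_iff kcnj_add kcnj_scaleR)

lemmas ktrans_linear_simps [simp] =
  linear_add[OF linear_ktrans] linear_diff[OF linear_ktrans] linear_neg[OF linear_ktrans]
  linear_scale[OF linear_ktrans] linear_0[OF linear_ktrans]

lemma ktrans_mat_1 [simp]: "(mat 1 :: 'k::real_or_complex^'p^'p)\<^sup>\<dagger> = mat 1"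
  by (auto simp: ktrans_def vec_eq_iff mat_def kcnj_one kcnj_zero)

lemma bounded_linear_ktrans:
  "bounded_linear (ktrans :: 'k::real_or_complex^'c::finite^'r::finite \<Rightarrow> 'k^'r^'c)"
  by (rule linear_conv_bounded_linear[THEN iffD1, OF linear_ktrans])

lemma bounded_bilinear_matrix_mult:
  "bounded_bilinear ((**) :: 'k::real_or_complex^'b::finite^'a::finite \<Rightarrow> 'k^'c::finite^'b \<Rightarrow> 'k^'c^'a)"
  unfolding bilinear_conv_bounded_bilinear[symmetric] bilinear_def linear_iff
  by (simp add: matrix_matrix_mult_def vec_eq_iff algebra_simps sum.distrib scaleR_sum_right)

interpretation mm: bounded_bilinear
  "(**) :: 'k::real_or_complex^'b::finite^'a::finite \<Rightarrow> 'k^'c::finite^'b \<Rightarrow> 'k^'c^'a"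
  by (rule bounded_bilinear_matrix_mult)

lemmas matrix_ring_simps =
  matrix_mul_assoc mm.add_left mm.add_right mm.diff_left mm.diff_right mm.minus_left mm.minus_right
  mm.scaleR_left mm.scaleR_right mm.zero_left mm.zero_right

lemma inner_ktrans_ktrans: "inner (A\<^sup>\<dagger>) (B\<^sup>\<dagger>) = inner A (B::'k::real_or_complex^'c::finite^'r::finite)"
proof -
  have "kre (trace (A ** B\<^sup>\<dagger>)) = kre (trace (B\<^sup>\<dagger> ** A))"
    by (simp add: trace_mul_sym[of A])
  then show ?thesis
    using kre_trace_eq_inner[of "A\<^sup>\<dagger>" "B\<^sup>\<dagger>"] kre_trace_eq_inner[of B A] by (simp add: inner_commute)
qed

text \<open>
  Multiplication by the conjugate transpose is adjoint to multiplication, on either side. These rules move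
  factors across an inner product, which is how all pairings below are evaluated.
\<close>

lemma inner_mult_left:
  "inner (A ** B) C = inner B ((A::'k::real_or_complex^'b::finite^'a::finite)\<^sup>\<dagger> ** (C::'k^'c::finite^'a))"
  by (simp add: kre_trace_eq_inner[symmetric] matrix_mul_assoc)

lemma inner_mult_right:
  "inner (A ** B) C = inner (A::'k::real_or_complex^'b::finite^'a::finite) (C ** (B::'k^'c::finite^'b)\<^sup>\<dagger>)"
  using inner_mult_left[of "B\<^sup>\<dagger>" "A\<^sup>\<dagger>" "C\<^sup>\<dagger>"] inner_ktrans_ktrans[of "A ** B" C]
    inner_ktrans_ktrans[of A "C ** B\<^sup>\<dagger>"] by simp

lemma inner_mult_both:
  assumes "A\<^sup>\<dagger> = A" "B\<^sup>\<dagger> = (B::'k::real_or_complex^'p::finite^'p)"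
  shows "inner (A ** X ** B) Y = inner X (A ** Y ** B)"
  using inner_mult_left[of A X "Y ** B"] inner_mult_right[of "A ** X" B Y] assms
  by (simp add: matrix_mul_assoc)

lemma ktrans_sym_t [simp]: "(sym_t A)\<^sup>\<dagger> = sym_t A"
  by (simp add: sym_t_def add.commute)

lemma ktrans_skew_t [simp]: "(skew_t A)\<^sup>\<dagger> = - skew_t A"
  by (simp add: skew_t_def algebra_simps)

text \<open>
  Hermitian and skew matrices are orthogonal to each other, so a pairing with a matrix of one kind
  only sees the part of that kind.
\<close>

lemma inner_sym_t:
  fixes A :: "'k::real_or_complex^'p::finite^'p"
  assumes "H\<^sup>\<dagger> = H"
  shows "inner H (sym_t A) = inner H A"
  using inner_ktrans_ktrans[of H A] assms by (simp add: sym_t_def inner_add_right)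

lemma inner_skew_t:
  fixes A :: "'k::real_or_complex^'p::finite^'p"
  assumes "K\<^sup>\<dagger> = - K"
  shows "inner K (skew_t A) = inner K A"
  using inner_ktrans_ktrans[of K A] assms by (simp add: skew_t_def inner_diff_right)

lemma linear_sym_t: "linear (sym_t :: 'k::real_or_complex^'p::finite^'p \<Rightarrow> 'k^'p^'p)"
  by (rule linearI) (simp_all add: sym_t_def algebra_simps)

lemma linear_skew_t: "linear (skew_t :: 'k::real_or_complex^'p::finite^'p \<Rightarrow> 'k^'p^'p)"
  by (rule linearI) (simp_all add: skew_t_def algebra_simps)

section \<open>Positive self-adjoint operators\<close>

definition self_adjoint :: "('a::real_inner \<Rightarrow> 'a) \<Rightarrow> bool"
  where "self_adjoint A \<longleftrightarrow> linear A \<and> (\<forall>x y. inner (A x) y = inner x (A y))"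

definition positive_op :: "('a::real_inner \<Rightarrow> 'a) \<Rightarrow> bool"
  where "positive_op A \<longleftrightarrow> self_adjoint A \<and> (\<forall>x. x \<noteq> 0 \<longrightarrow> inner x (A x) > 0)"

lemma positive_op_nonneg: "positive_op A \<Longrightarrow> inner x (A x) \<ge> 0"
  by (cases "x = 0") (auto simp: positive_op_def less_imp_le)

lemma positive_op_bij:
  fixes A :: "'a::euclidean_space \<Rightarrow> 'a"
  assumes "positive_op A"
  shows "bij A"
proof -
  have lin: "linear A" using assms by (simp add: positive_op_def self_adjoint_def)
  have "inj A"
    unfolding linear_injective_0[OF lin]
    using assms by (metis inner_zero_right less_irrefl positive_op_def)
  then show ?thesis
    using lin linear_injective_imp_surjective by (auto simp: bij_def)
qed

text \<open>
  The minimum of the quadratic form over the unit sphere is attained by compactness, and there the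
  residual \<open>A x - l x\<close> vanishes by stationarity. The subspace \<open>S\<close> will be an eigenspace of a commuting
  operator, which makes \<open>x\<close> a common eigenvector.
\<close>

lemma self_adjoint_min_eigenvector:
  fixes A :: "'a::euclidean_space \<Rightarrow> 'a"
  assumes A: "self_adjoint A" and S: "subspace S" "\<And>x. x \<in> S \<Longrightarrow> A x \<in> S"
    and z: "z \<in> S" "z \<noteq> 0"
  obtains x l where "x \<in> S" "norm x = 1" "A x = l *\<^sub>R x" "\<And>y. y \<in> S \<Longrightarrow> l * inner y y \<le> inner y (A y)"
proof -
  have lin: "linear A" and adj: "\<And>x y. inner (A x) y = inner x (A y)"
    using A by (auto simp: self_adjoint_def)
  let ?K = "S \<inter> sphere 0 1"
  have "compact ?K"
    using closed_subspace[OF S(1)] by (simp add: closed_Int_compact)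
  moreover have "(1 / norm z) *\<^sub>R z \<in> ?K"
    using z S(1) by (simp add: subspace_scale)
  moreover have "continuous_on ?K (\<lambda>x. inner x (A x))"
    by (intro continuous_intros linear_continuous_on_compose[OF _ lin])
  ultimately obtain x where x: "x \<in> ?K" and min: "\<And>y. y \<in> ?K \<Longrightarrow> inner x (A x) \<le> inner y (A y)"
    using continuous_attains_inf[of ?K "\<lambda>x. inner x (A x)"] by blast
  define l where "l = inner x (A x)"
  have nx: "inner x x = 1" using x by (simp add: norm_eq_sqrt_inner)
  have bound: "l * inner y y \<le> inner y (A y)" if "y \<in> S" for y
  proof (cases "y = 0")
    case False
    have "(1 / norm y) *\<^sub>R y \<in> ?K" using False that S(1) by (simp add: subspace_scale)
    from min[OF this] have "l \<le> inner y (A y) / (norm y)\<^sup>2"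
      by (simp add: l_def linear_scale[OF lin] power2_eq_square)
    then show ?thesis using False by (simp add: pos_le_divide_eq power2_norm_eq_inner)
  qed (simp add: linear_0[OF lin])
  define r where "r = A x - l *\<^sub>R x"
  have rS: "r \<in> S" unfolding r_def using x S by (simp add: subspace_diff subspace_scale)
  have lx: "inner x (A x) = l" by (simp add: l_def)
  \<comment> \<open>Moving from the minimiser \<open>x\<close> a distance \<open>- t\<close> along the residual \<open>r\<close> changes the quadratic form of
    \<open>A - l\<close>, which is nonnegative and vanishes at \<open>x\<close>, by \<open>- 2 t \<bar>r\<bar>\<^sup>2 + O(t\<^sup>2)\<close>.\<close>
  define q where "q = inner r (A r) - l * inner r r"
  have quad: "0 \<le> - 2 * t * inner r r + t\<^sup>2 * q" for t
  proof -
    have "x - t *\<^sub>R r \<in> S" using x rS S(1) by (simp add: subspace_diff subspace_scale)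
    from bound[OF this]
    have "0 \<le> inner (x - t *\<^sub>R r) (A (x - t *\<^sub>R r)) - l * inner (x - t *\<^sub>R r) (x - t *\<^sub>R r)" by simp
    also have "\<dots> = - 2 * t * (inner r (A x) - l * inner r x) + t\<^sup>2 * q + (inner x (A x) - l * inner x x)"
      using adj[of x r]
      by (simp add: q_def linear_diff[OF lin] linear_scale[OF lin] inner_diff_left inner_diff_right
          inner_commute power2_eq_square algebra_simps)
    also have "inner r (A x) - l * inner r x = inner r r"
      by (simp add: r_def inner_diff_left inner_diff_right)
    finally show ?thesis by (simp add: lx nx)
  qed
  have "inner r r = 0"
  proof (rule ccontr)
    assume "inner r r \<noteq> 0"
    then have rp: "inner r r > 0" by simp
    define t where "t = inner r r / (\<bar>q\<bar> + 1)"
    have tp: "t > 0" using rp by (simp add: t_def)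
    have "t\<^sup>2 * q \<le> t * (t * (\<bar>q\<bar> + 1))"
      using tp by (simp add: power2_eq_square mult_left_mono)
    also have "t * (\<bar>q\<bar> + 1) = inner r r"
      by (simp add: t_def)
    finally show False using quad[of t] mult_pos_pos[OF tp rp] by linarith
  qed
  then have "A x = l *\<^sub>R x" by (simp add: r_def)
  then show ?thesis using that[of x l] x bound by auto
qed

text \<open>
  An operator is positive as soon as its eigenvalues are, since the minimum of its quadratic form on
  the unit sphere is an eigenvalue.
\<close>

lemma positive_opI:
  fixes A :: "'a::euclidean_space \<Rightarrow> 'a"
  assumes A: "self_adjoint A" and ev: "\<And>x l. x \<noteq> 0 \<Longrightarrow> A x = l *\<^sub>R x \<Longrightarrow> l > 0"
  shows "positive_op A"
  unfolding positive_op_def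
proof (intro conjI allI impI)
  fix y :: 'a assume "y \<noteq> 0"
  then obtain x l where "norm x = 1" "A x = l *\<^sub>R x" and l: "\<And>y. l * inner y y \<le> inner y (A y)"
    using self_adjoint_min_eigenvector[OF A subspace_UNIV, of y] by auto
  then have "l > 0" using ev[of x l] by fastforce
  with \<open>y \<noteq> 0\<close> have "0 < l * inner y y" by simp
  then show "0 < inner y (A y)" using l[of y] by simp
qed fact

text \<open>
  Commuting positive operators are simultaneously diagonalisable. It is enough to find one common
  eigenvector in each eigenspace of the product: there the eigenvalue of the product is the product
  of two positive eigenvalues.
\<close>

lemma positive_op_compose:
  fixes A B :: "'a::euclidean_space \<Rightarrow> 'a"
  assumes A: "positive_op A" and B: "positive_op B" and comm: "\<And>x. A (B x) = B (A x)"
  shows "positive_op (\<lambda>x. A (B x))"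
proof (rule positive_opI)
  have lin: "linear A" "linear B" and adj: "\<And>x y. inner (A x) y = inner x (A y)"
    "\<And>x y. inner (B x) y = inner x (B y)"
    using A B by (auto simp: positive_op_def self_adjoint_def)
  then show "self_adjoint (\<lambda>x. A (B x))"
    using linear_compose[OF lin(2,1)] by (simp add: self_adjoint_def comp_def comm)
  fix z l assume z: "z \<noteq> 0" "A (B z) = l *\<^sub>R z"
  let ?S = "{x. A (B x) = l *\<^sub>R x}"
  have "subspace ?S"
    by (simp add: subspace_def linear_0 linear_add linear_scale lin scaleR_add_right)
  moreover have "A x \<in> ?S" if "x \<in> ?S" for x
    using that by (simp add: comm[symmetric] linear_scale lin)
  ultimately obtain x a where x: "x \<in> ?S" "norm x = 1" "A x = a *\<^sub>R x"
    using self_adjoint_min_eigenvector[of A ?S z thesis] A z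
    by (simp add: positive_op_def) blast
  have nx: "x \<noteq> 0" "inner x x = 1" using x(2) by (auto simp: norm_eq_sqrt_inner)
  have a: "a > 0" using A x(3) nx by (auto simp: positive_op_def)
  have "a * inner x (B x) = l"
    using x(1,3) nx by (simp add: comm linear_scale lin) (metis inner_scaleR_right mult.right_neutral)
  then show "l > 0" using a B nx by (auto simp: positive_op_def)
qed

lemma positive_op_inverse:
  assumes A: "positive_op A" and B: "\<And>x. A (B x) = x" and lin: "linear B"
  shows "positive_op B"
proof -
  have adj: "\<And>x y. inner (A x) y = inner x (A y)" and pos: "\<And>x. x \<noteq> 0 \<Longrightarrow> inner x (A x) > 0"
    using A by (auto simp: positive_op_def self_adjoint_def)
  have "inner (B x) y = inner x (B y)" for x y
    using adj[of "B x" "B y"] by (simp add: B)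
  moreover have "inner x (B x) > 0" if "x \<noteq> 0" for x
    using pos[of "B x"] adj[of "B x" "B x"] that B[of x] A
    by (metis B inner_commute inner_eq_zero_iff inner_zero_left linear_0 positive_op_def self_adjoint_def)
  ultimately show ?thesis
    using lin by (simp add: positive_op_def self_adjoint_def)
qed

section \<open>Positive definite matrices\<close>

lemma matrix_inv_mult:
  fixes A :: "'a::semiring_1^'n^'n"
  assumes "A ** B = mat 1" "B ** A = mat 1"
  shows "A ** matrix_inv A = mat 1" "matrix_inv A ** A = mat 1" "matrix_inv A = B"
proof -
  have inv: "A ** matrix_inv A = mat 1 \<and> matrix_inv A ** A = mat 1"
    unfolding matrix_inv_def by (rule someI[of _ B]) (use assms in blast)
  then show "A ** matrix_inv A = mat 1" "matrix_inv A ** A = mat 1" by auto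
  show "matrix_inv A = B"
    by (metis inv assms(2) matrix_mul_assoc matrix_mul_lid matrix_mul_rid)
qed

text \<open>
  Products are normalised to associate to the left, so cancellation inside a product needs the laws
  with a prefix \<open>X\<close>.
\<close>

lemma matrix_inv_simps:
  fixes P :: "'k::real_or_complex^'p::finite^'p"
  assumes "invertible P"
  shows "P ** matrix_inv P = mat 1" "matrix_inv P ** P = mat 1"
    "X ** P ** matrix_inv P = X" "X ** matrix_inv P ** P = X"
proof -
  from assms obtain B where "P ** B = mat 1" "B ** P = mat 1"
    by (auto simp: invertible_def)
  from matrix_inv_mult(1,2)[OF this] show *: "P ** matrix_inv P = mat 1" "matrix_inv P ** P = mat 1" .
  show "X ** P ** matrix_inv P = X" "X ** matrix_inv P ** P = X"
    by (simp_all add: matrix_mul_assoc[symmetric] *)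
qed

lemma pos_def_ktrans: "P \<in> pos_def_matrices \<Longrightarrow> P\<^sup>\<dagger> = P"
  by (simp add: pos_def_matrices_def)

text \<open>
  Left multiplication by a matrix has the real eigenvalues of the matrix: the columns of an
  eigenvector, which is a matrix, are eigenvectors of the matrix itself.
\<close>

lemma positive_op_mult_left:
  fixes P :: "'k::real_or_complex^'p::finite^'p"
  assumes P: "P \<in> pos_def_matrices"
  shows "positive_op (\<lambda>Y::'k^'q::finite^'p. P ** Y)"
proof (rule positive_opI)
  show "self_adjoint (\<lambda>Y::'k^'q::finite^'p. P ** Y)"
    using bounded_linear.linear[OF mm.bounded_linear_right[of P]] pos_def_ktrans[OF P]
    by (simp add: self_adjoint_def inner_mult_left)
  fix Y :: "'k^'q^'p" and l
  assume Y: "Y \<noteq> 0" "P ** Y = l *\<^sub>R Y"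
  then obtain i j where ij: "Y $ i $ j \<noteq> 0" by (auto simp: vec_eq_iff)
  have "P *v column j Y = of_real l *s column j Y"
    using arg_cong[OF Y(2), of "column j"]
    by (simp add: vec_eq_iff column_def matrix_vector_mult_def matrix_matrix_mult_def
        scaleR_conv_of_real[where 'a = 'k])
  moreover have "column j Y \<noteq> 0"
    using ij by (auto simp: column_def vec_eq_iff)
  ultimately have "is_eigenvalue P (of_real l)"
    unfolding is_eigenvalue_def by blast
  then show "l > 0" using P by (auto simp: pos_def_matrices_def)
qed

lemma pos_def_invertible:
  fixes P :: "'k::real_or_complex^'p::finite^'p"
  assumes "P \<in> pos_def_matrices"
  shows "invertible P"
proof -
  obtain B where "P ** B = (mat 1 :: 'k^'p^'p)"
    using positive_op_bij[OF positive_op_mult_left[OF assms]] by (metis bij_pointE)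
  then show ?thesis by (auto simp: invertible_right_inverse)
qed

lemma ktrans_matrix_inv:
  fixes P :: "'k::real_or_complex^'p::finite^'p"
  assumes "invertible P" "P\<^sup>\<dagger> = P"
  shows "(matrix_inv P)\<^sup>\<dagger> = matrix_inv P"
proof -
  have "P ** (matrix_inv P)\<^sup>\<dagger> = mat 1" "(matrix_inv P)\<^sup>\<dagger> ** P = mat 1"
    using arg_cong[OF matrix_inv_simps(2)[OF assms(1)], of ktrans]
      arg_cong[OF matrix_inv_simps(1)[OF assms(1)], of ktrans] by (simp_all add: assms(2))
  from matrix_inv_mult(3)[OF this] show ?thesis by simp
qed

lemma positive_op_mult_right:
  fixes P :: "'k::real_or_complex^'p::finite^'p"
  assumes P: "P \<in> pos_def_matrices"
  shows "positive_op (\<lambda>Y::'k^'p^'q::finite. Y ** P)"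
  unfolding positive_op_def self_adjoint_def
proof (intro conjI allI impI)
  fix x y :: "'k^'p^'q"
  show "inner (x ** P) y = inner x (y ** P)"
    using inner_mult_right[of x P y] pos_def_ktrans[OF P] by simp
  assume "x \<noteq> 0"
  then have "x\<^sup>\<dagger> \<noteq> 0" using ktrans_ktrans[of x] by force
  then have "inner (x\<^sup>\<dagger>) (P ** x\<^sup>\<dagger>) > 0"
    using positive_op_mult_left[OF P] by (auto simp: positive_op_def)
  then show "inner x (x ** P) > 0"
    using inner_ktrans_ktrans[of x "x ** P"] pos_def_ktrans[OF P] by simp
qed (rule bounded_linear.linear[OF mm.bounded_linear_left])

lemma positive_op_mult_inv:
  fixes P :: "'k::real_or_complex^'p::finite^'p"
  assumes P: "P \<in> pos_def_matrices"
  shows "positive_op (\<lambda>Y::'k^'q::finite^'p. matrix_inv P ** Y)"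
    and "positive_op (\<lambda>Y::'k^'p^'q::finite. Y ** matrix_inv P)"
proof -
  note inv = matrix_inv_simps[OF pos_def_invertible[OF P]]
  show "positive_op (\<lambda>Y::'k^'q::finite^'p. matrix_inv P ** Y)"
    by (rule positive_op_inverse[OF positive_op_mult_left[OF P]])
      (simp_all add: matrix_mul_assoc inv bounded_linear.linear[OF mm.bounded_linear_right])
  show "positive_op (\<lambda>Y::'k^'p^'q::finite. Y ** matrix_inv P)"
    by (rule positive_op_inverse[OF positive_op_mult_right[OF P]])
      (simp_all add: inv bounded_linear.linear[OF mm.bounded_linear_left])
qed

lemma positive_op_conj:
  fixes P :: "'k::real_or_complex^'p::finite^'p"
  assumes P: "P \<in> pos_def_matrices"
  shows "positive_op (\<lambda>Y::'k^'p^'p. matrix_inv P ** Y ** matrix_inv P)"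
    and "positive_op (\<lambda>Y::'k^'p^'p. P ** Y ** matrix_inv P)"
proof -
  show "positive_op (\<lambda>Y::'k^'p^'p. matrix_inv P ** Y ** matrix_inv P)"
    using positive_op_compose[OF positive_op_mult_inv(2)[OF P] positive_op_mult_inv(1)[OF P]]
    by (simp add: matrix_mul_assoc)
  show "positive_op (\<lambda>Y::'k^'p^'p. P ** Y ** matrix_inv P)"
    using positive_op_compose[OF positive_op_mult_inv(2)[OF P] positive_op_mult_left[OF P]]
    by (simp add: matrix_mul_assoc)
qed

lemma linear_L_op: "linear (L_op \<beta> \<delta> (P :: 'k::real_or_complex^'p::finite^'p))"
  by (rule linearI) (simp_all add: L_op_def matrix_ring_simps algebra_simps)

lemma ktrans_L_op:
  fixes P :: "'k::real_or_complex^'p::finite^'p"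
  assumes "P \<in> pos_def_matrices"
  shows "(L_op \<beta> \<delta> P X)\<^sup>\<dagger> = L_op \<beta> \<delta> P (X\<^sup>\<dagger>)"
  using ktrans_matrix_inv[OF pos_def_invertible[OF assms] pos_def_ktrans[OF assms]]
  by (simp add: L_op_def pos_def_ktrans[OF assms] matrix_mul_assoc add.commute)

text \<open>
  With \<open>A X = P X P\<^sup>-\<^sup>1\<close>, the operator \<open>L_op \<beta> \<delta> P\<close> is
  \<open>1/\<beta> + 1/\<delta> (A - 2 + A\<^sup>-\<^sup>1) = 1/\<beta> + 1/\<delta> (1 - A\<^sup>-\<^sup>1) A (1 - A\<^sup>-\<^sup>1)\<close>, and \<open>A\<close> is positive; so \<open>L_op \<beta> \<delta> P\<close> is
  bounded below by \<open>1/\<beta>\<close>.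
\<close>

lemma positive_op_L_op:
  fixes P :: "'k::real_or_complex^'p::finite^'p"
  assumes P: "P \<in> pos_def_matrices" and "\<beta> > 0" "\<delta> > 0"
  shows "positive_op (L_op \<beta> \<delta> P)"
proof -
  let ?Q = "matrix_inv P"
  note inv = matrix_inv_simps[OF pos_def_invertible[OF P]]
  have sa: "P\<^sup>\<dagger> = P" "?Q\<^sup>\<dagger> = ?Q"
    using pos_def_ktrans[OF P] ktrans_matrix_inv[OF pos_def_invertible[OF P]] by auto
  have "inner (L_op \<beta> \<delta> P X) Y = inner X (L_op \<beta> \<delta> P Y)" for X Y
    by (simp add: L_op_def inner_add_left inner_add_right inner_mult_both sa)
  moreover have "inner X (L_op \<beta> \<delta> P X) > 0" if "X \<noteq> 0" for X
  proof -
    define Z where "Z = X - ?Q ** X ** P"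
    have "inner Z (P ** Z ** ?Q) = inner X (P ** Z ** ?Q) - inner X (?Q ** (P ** Z ** ?Q) ** P)"
      unfolding Z_def by (simp add: inner_diff_left inner_mult_both sa)
    also have "\<dots> = inner X (P ** X ** ?Q) - 2 * inner X X + inner X (?Q ** X ** P)"
      by (simp add: Z_def matrix_ring_simps inv inner_diff_right)
    finally have form: "inner Z (P ** Z ** ?Q)
        = inner X (P ** X ** ?Q) - 2 * inner X X + inner X (?Q ** X ** P)" .
    have "inner X (L_op \<beta> \<delta> P X) = inner X X / \<beta> + inner Z (P ** Z ** ?Q) / \<delta>"
      unfolding form by (simp add: L_op_def inner_add_right algebra_simps diff_divide_distrib add_divide_distrib)
    moreover have "inner Z (P ** Z ** ?Q) \<ge> 0"
      by (rule positive_op_nonneg[OF positive_op_conj(2)[OF P]])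
    moreover have "inner X X / \<beta> > 0" using that \<open>\<beta> > 0\<close> by simp
    moreover have "inner Z (P ** Z ** ?Q) / \<delta> \<ge> 0" using calculation(2) \<open>\<delta> > 0\<close> by simp
    ultimately show ?thesis by linarith
  qed
  ultimately show ?thesis
    using linear_L_op by (simp add: positive_op_def self_adjoint_def)
qed

lemma ktrans_inv_L_op:
  fixes P :: "'k::real_or_complex^'p::finite^'p"
  assumes P: "P \<in> pos_def_matrices" and "\<beta> > 0" "\<delta> > 0" and Z: "Z\<^sup>\<dagger> = Z"
  shows "(inv (L_op \<beta> \<delta> P) Z)\<^sup>\<dagger> = inv (L_op \<beta> \<delta> P) Z"
proof -
  have bij: "bij (L_op \<beta> \<delta> P)" by (rule positive_op_bij[OF positive_op_L_op[OF assms(1-3)]])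
  have "L_op \<beta> \<delta> P ((inv (L_op \<beta> \<delta> P) Z)\<^sup>\<dagger>) = Z"
    using bij Z by (simp add: ktrans_L_op[OF P, symmetric] bij_def surj_f_inv_f)
  then show ?thesis using bij by (metis bij_inv_eq_iff)
qed

section \<open>Differentiating the solution of a linear system\<close>

text \<open>
  The product is of higher order because \<open>\<psi>\<close> is of first order and \<open>\<phi>\<close> tends to \<open>0\<close>. Below, \<open>\<phi>\<close> is a
  component of the solution whose differentiability is to be shown, so only its continuity is at
  hand.
\<close>

lemma has_derivative_scaleR_vanishing:
  fixes \<phi> :: "'a::real_normed_vector \<Rightarrow> real" and \<psi> :: "'a \<Rightarrow> 'b::real_normed_vector"
  assumes \<phi>: "(\<phi> \<longlongrightarrow> 0) (at y)" and \<psi>: "(\<psi> has_derivative \<psi>') (at y)" "\<psi> y = 0"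
  shows "((\<lambda>z. \<phi> z *\<^sub>R \<psi> z) has_derivative (\<lambda>_. 0)) (at y)"
  unfolding has_derivative_iff_norm
proof (intro conjI bounded_linear_zero)
  have bl: "bounded_linear \<psi>'" using \<psi>(1) by (rule has_derivative_bounded_linear)
  then obtain B where B: "\<And>x. norm (\<psi>' x) \<le> norm x * B"
    using bounded_linear.bounded by blast
  define r where "r = (\<lambda>z. norm (\<psi> z - \<psi> y - \<psi>' (z - y)) / norm (z - y))"
  have r: "(r \<longlongrightarrow> 0) (at y)" using \<psi>(1) by (simp add: r_def has_derivative_iff_norm)
  have lim: "((\<lambda>z. \<bar>\<phi> z\<bar> * (r z + B)) \<longlongrightarrow> \<bar>0\<bar> * (0 + B)) (at y)"
    by (intro tendsto_intros \<phi> r)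
  have bound: "norm (\<phi> z *\<^sub>R \<psi> z) / norm (z - y) \<le> \<bar>\<phi> z\<bar> * (r z + B)" if "z \<noteq> y" for z
  proof -
    have "norm (\<psi> z) \<le> norm (\<psi> z - \<psi> y - \<psi>' (z - y)) + norm (\<psi>' (z - y))"
      using norm_triangle_ineq[of "\<psi> z - \<psi>' (z - y)" "\<psi>' (z - y)"] by (simp add: \<psi>(2))
    also have "\<dots> \<le> norm (\<psi> z - \<psi> y - \<psi>' (z - y)) + norm (z - y) * B"
      using B by simp
    finally have "norm (\<psi> z) / norm (z - y) \<le> r z + B"
      using that by (simp add: r_def field_simps)
    then have "\<bar>\<phi> z\<bar> * (norm (\<psi> z) / norm (z - y)) \<le> \<bar>\<phi> z\<bar> * (r z + B)"
      by (rule mult_left_mono) simp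
    then show ?thesis by simp
  qed
  from bound have "eventually (\<lambda>z. norm (norm (\<phi> z *\<^sub>R \<psi> z) / norm (z - y)) \<le> \<bar>\<phi> z\<bar> * (r z + B)) (at y)"
    by (intro eventually_mono[OF eventually_neq_at_within[of y y]]) simp
  then have "((\<lambda>z. norm (\<phi> z *\<^sub>R \<psi> z) / norm (z - y)) \<longlongrightarrow> 0) (at y)"
    by (rule Lim_null_comparison) (use lim in simp)
  then show "((\<lambda>z. norm (\<phi> z *\<^sub>R \<psi> z - \<phi> y *\<^sub>R \<psi> y - 0) / norm (z - y)) \<longlongrightarrow> 0) (at y)"
    by (simp add: \<psi>(2))
qed

lemma linear_sum_Basis:
  fixes f :: "'e::euclidean_space \<Rightarrow> 'b::real_vector"
  assumes "linear f"
  shows "f x = (\<Sum>i\<in>Basis. (x \<bullet> i) *\<^sub>R f i)"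
proof -
  have "f x = f (\<Sum>i\<in>Basis. (x \<bullet> i) *\<^sub>R i)" by (simp add: euclidean_representation)
  then show ?thesis by (simp add: linear_sum[OF assms] linear_scale[OF assms])
qed

lemma linear_inv_bij:
  assumes "linear f" "bij f"
  shows "linear (inv f)"
proof (rule linearI)
  have inj: "inj f" and surj: "\<And>y. f (inv f y) = y"
    using \<open>bij f\<close> by (auto simp: bij_def surj_f_inv_f)
  show "inv f (x + y) = inv f x + inv f y" for x y
    by (rule inv_f_eq[OF inj]) (simp add: linear_add[OF assms(1)] surj)
  show "inv f (r *\<^sub>R x) = r *\<^sub>R inv f x" for r x
    by (rule inv_f_eq[OF inj]) (simp add: linear_scale[OF assms(1)] surj)
qed

text \<open>
  The operators near an injective one are bounded below by a common constant, so the solution \<open>u\<close>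
  of \<open>A z (u z) = b z\<close> is continuous. Subtracting the equation at \<open>y\<close>,
  \<open>A y (u z - u y) = (b z - b y) - (A z - A y) (u y) - (A z - A y) (u z - u y)\<close>, where the last term
  is of higher order.
\<close>

lemma
  fixes A :: "'a::real_normed_vector \<Rightarrow> 'e::euclidean_space \<Rightarrow> 'e"
  assumes lin: "\<And>z. linear (A z)" and A': "\<And>x. ((\<lambda>z. A z x) has_derivative (\<lambda>v. A' v x)) (at y)"
    and bij: "bij (A y)"
  shows eventually_bij: "eventually (\<lambda>z. bij (A z)) (nhds y)"
    and has_derivative_linear_system:
      "(b has_derivative b') (at y) \<Longrightarrow>
       ((\<lambda>z. inv (A z) (b z)) has_derivative (\<lambda>v. inv (A y) (b' v - A' v (inv (A y) (b y))))) (at y)"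
proof -
  obtain c where c: "c > 0" "\<And>x. c * norm x \<le> norm (A y x)"
    using linear_inj_bounded_below_pos[OF lin] bij by (metis bij_def)
  define s where "s z = (\<Sum>i\<in>Basis. norm (A z i - A y i))" for z
  have near: "norm (A z x - A y x) \<le> norm x * s z" for z x
  proof -
    have "A z x - A y x = (\<Sum>i\<in>Basis. (x \<bullet> i) *\<^sub>R (A z i - A y i))"
      using linear_sum_Basis[OF lin, of z x] linear_sum_Basis[OF lin, of y x]
      by (simp add: scaleR_diff_right sum_subtractf)
    also have "norm \<dots> \<le> (\<Sum>i\<in>Basis. norm x * norm (A z i - A y i))"
      by (intro sum_norm_le) (simp add: mult_right_mono Basis_le_norm)
    finally show ?thesis by (simp add: s_def sum_distrib_left)
  qed
  have cont: "((\<lambda>z. A z x) \<longlongrightarrow> A y x) (nhds y)" for x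
    using has_derivative_continuous[OF A'] tendsto_at_iff_tendsto_nhds[of "\<lambda>z. A z x" y]
    by (simp add: continuous_at)
  have "((\<lambda>z. \<Sum>i\<in>Basis. norm (A z i - A y i)) \<longlongrightarrow> (\<Sum>i\<in>(Basis::'e set). norm (A y i - A y i))) (nhds y)"
    by (intro tendsto_intros cont)
  then have "(s \<longlongrightarrow> 0) (nhds y)" by (simp add: s_def[abs_def])
  then have "eventually (\<lambda>z. s z < c / 2) (nhds y)" using c(1) by (intro order_tendstoD(2)[of s 0]) auto
  then have below: "eventually (\<lambda>z. \<forall>x. c / 2 * norm x \<le> norm (A z x)) (nhds y)"
  proof (rule eventually_mono, intro allI)
    fix z and x :: 'e assume "s z < c / 2"
    then have "norm x * s z \<le> norm x * (c / 2)" by (intro mult_left_mono) auto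
    then show "c / 2 * norm x \<le> norm (A z x)"
      using near[of z x] c(2)[of x] norm_triangle_ineq2[of "A y x" "A z x"]
      by (simp add: norm_minus_commute algebra_simps)
  qed
  show evb: "eventually (\<lambda>z. bij (A z)) (nhds y)"
    using below
  proof (rule eventually_mono)
    fix z assume *: "\<forall>x. c / 2 * norm x \<le> norm (A z x)"
    have "inj (A z)"
      unfolding linear_injective_0[OF lin]
    proof (intro allI impI)
      fix x assume "A z x = 0"
      then show "x = 0" using *[rule_format, of x] c(1) by (simp add: mult_le_0_iff)
    qed
    then show "bij (A z)" using linear_injective_imp_surjective[OF lin] by (auto simp: bij_def)
  qed
  assume b: "(b has_derivative b') (at y)"
  define u where "u z = inv (A z) (b z)" for z
  have Auy: "A y (u y) = b y" using bij by (simp add: u_def bij_def surj_f_inv_f)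
  have ev: "eventually (\<lambda>z. A z (u z) = b z \<and> (\<forall>x. c / 2 * norm x \<le> norm (A z x))) (nhds y)"
    using eventually_conj[OF evb below]
    by (rule eventually_mono) (auto simp: u_def bij_def surj_f_inv_f)
  have contu: "((\<lambda>z. u z - u y) \<longlongrightarrow> 0) (at y)"
  proof (rule Lim_null_comparison)
    show "eventually (\<lambda>z. norm (u z - u y) \<le> 2 / c * norm (b z - A z (u y))) (at y)"
    proof (rule eventually_mono[OF ev[THEN filter_leD[OF at_within_le_nhds]]])
      fix z assume *: "A z (u z) = b z \<and> (\<forall>x. c / 2 * norm x \<le> norm (A z x))"
      then have "c / 2 * norm (u z - u y) \<le> norm (b z - A z (u y))"
        by (metis linear_diff[OF lin])
      then show "norm (u z - u y) \<le> 2 / c * norm (b z - A z (u y))"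
        using c(1) by (simp add: field_simps)
    qed
    have "((\<lambda>z. 2 / c * norm (b z - A z (u y))) \<longlongrightarrow> 2 / c * norm (b y - A y (u y))) (at y)"
      by (intro tendsto_intros cont[THEN filterlim_mono[OF _ order_refl at_within_le_nhds]]
          has_derivative_continuous[OF b, unfolded continuous_within])
    then show "((\<lambda>z. 2 / c * norm (b z - A z (u y))) \<longlongrightarrow> 0) (at y)" by (simp add: Auy)
  qed
  define w where "w z = (\<Sum>i\<in>Basis. ((u z - u y) \<bullet> i) *\<^sub>R (A z i - A y i))" for z
  have w: "A z (u z - u y) - A y (u z - u y) = w z" for z
    using linear_sum_Basis[OF lin, of z "u z - u y"] linear_sum_Basis[OF lin, of y "u z - u y"]
    by (simp add: w_def scaleR_diff_right sum_subtractf)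
  have "(w has_derivative (\<lambda>v. \<Sum>i\<in>(Basis::'e set). 0)) (at y)"
    unfolding w_def[abs_def]
  proof (intro has_derivative_sum)
    fix i :: 'e
    have "((\<lambda>z. (u z - u y) \<bullet> i) \<longlongrightarrow> 0 \<bullet> i) (at y)" by (intro tendsto_intros contu)
    moreover have "((\<lambda>z. A z i - A y i) has_derivative (\<lambda>v. A' v i - 0)) (at y)"
      by (intro has_derivative_diff A' has_derivative_const)
    ultimately show "((\<lambda>z. ((u z - u y) \<bullet> i) *\<^sub>R (A z i - A y i)) has_derivative (\<lambda>v. 0)) (at y)"
      by (intro has_derivative_scaleR_vanishing) auto
  qed
  then have w': "(w has_derivative (\<lambda>v. 0)) (at y)" by simp
  note li = linear_inv_bij[OF lin bij]
  have "((\<lambda>z. inv (A y) (b z - (A z (u y) + w z))) has_derivative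
      (\<lambda>v. inv (A y) (b' v - (A' v (u y) + 0)))) (at y)"
    by (rule bounded_linear.has_derivative[OF linear_conv_bounded_linear[THEN iffD1, OF li]])
      (intro has_derivative_diff has_derivative_add b A' w')
  then have "((\<lambda>z. u y + inv (A y) (b z - (A z (u y) + w z))) has_derivative
      (\<lambda>v. 0 + inv (A y) (b' v - (A' v (u y) + 0)))) (at y)"
    by (intro has_derivative_add has_derivative_const)
  moreover have "eventually (\<lambda>z. u y + inv (A y) (b z - (A z (u y) + w z)) = u z) (nhds y)"
  proof (rule eventually_mono[OF ev])
    fix z assume "A z (u z) = b z \<and> (\<forall>x. c / 2 * norm x \<le> norm (A z x))"
    then have "b z - (A z (u y) + w z) = A y (u z - u y)"
      by (simp add: w[symmetric] linear_diff[OF lin] algebra_simps)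
    then show "u y + inv (A y) (b z - (A z (u y) + w z)) = u z"
      using bij by (simp add: bij_def)
  qed
  ultimately have "(u has_derivative (\<lambda>v. 0 + inv (A y) (b' v - (A' v (u y) + 0)))) (at y)"
    by (rule has_derivative_transform_eventually[OF _ filter_leD[OF at_within_le_nhds]])
      (simp_all add: w_def Auy linear_0[OF li])
  then show "((\<lambda>z. inv (A z) (b z)) has_derivative (\<lambda>v. inv (A y) (b' v - A' v (inv (A y) (b y))))) (at y)"
    by (simp add: u_def[abs_def])
qed

lemma bij_mult_left:
  fixes P :: "'k::real_or_complex^'p::finite^'p"
  shows "bij (\<lambda>X::'k^'p^'p. P ** X) \<longleftrightarrow> invertible P"
proof
  assume "bij (\<lambda>X::'k^'p^'p. P ** X)"
  then obtain B where "P ** B = mat 1" by (metis bij_pointE)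
  then show "invertible P" by (auto simp: invertible_right_inverse)
next
  assume "invertible P"
  note inv = matrix_inv_simps[OF this]
  show "bij (\<lambda>X::'k^'p^'p. P ** X)"
    by (rule bijI'[where f = "\<lambda>X. P ** X"])
      (metis inv(2) matrix_mul_assoc matrix_mul_lid, metis inv(1) matrix_mul_assoc matrix_mul_lid)
qed

lemma inv_mult_left:
  fixes P :: "'k::real_or_complex^'p::finite^'p"
  assumes "invertible P"
  shows "inv (\<lambda>X::'k^'p^'p. P ** X) Z = matrix_inv P ** Z"
proof (rule inv_f_eq)
  show "inj (\<lambda>X::'k^'p^'p. P ** X)" using assms by (simp add: bij_mult_left[symmetric] bij_def)
qed (simp add: matrix_mul_assoc matrix_inv_simps[OF assms])

text \<open>
  The inverse of \<open>P\<close> solves \<open>P X = 1\<close>, so the results on linear systems apply with multiplication by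
  \<open>P\<close> as the operator.
\<close>

lemma open_invertible: "open {P :: 'k::real_or_complex^'p::finite^'p. invertible P}"
proof -
  have "eventually (\<lambda>Q::'k^'p^'p. bij (\<lambda>X::'k^'p^'p. Q ** X)) (nhds P)" if "invertible P" for P
    by (rule eventually_bij[where A = "\<lambda>Q X. Q ** X" and A' = "\<lambda>v X. v ** X"])
      (use that in \<open>auto simp: bij_mult_left bounded_linear.linear[OF mm.bounded_linear_right]
        intro!: bounded_linear_imp_has_derivative mm.bounded_linear_left\<close>)
  then show ?thesis
    unfolding bij_mult_left by (simp add: eventually_nhds open_subopen[of "{P. invertible P}"] subset_eq)
qed

lemma has_derivative_matrix_inv:
  fixes f :: "'a::real_normed_vector \<Rightarrow> 'k::real_or_complex^'p::finite^'p"
  assumes f: "(f has_derivative f') (at x)" and inv: "invertible (f x)"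
  shows "((\<lambda>x. matrix_inv (f x)) has_derivative
    (\<lambda>v. - (matrix_inv (f x) ** f' v ** matrix_inv (f x)))) (at x)"
proof -
  have cont: "isCont f x" using has_derivative_continuous[OF f] .
  have "((\<lambda>z. inv (\<lambda>X. f z ** X) (mat 1)) has_derivative
    (\<lambda>v. inv (\<lambda>X. f x ** X) (0 - f' v ** inv (\<lambda>X. f x ** X) (mat 1)))) (at x)"
    by (rule has_derivative_linear_system[where A = "\<lambda>z X. f z ** X" and b = "\<lambda>_. mat 1" and A' = "\<lambda>v X. f' v ** X"])
      (use inv in \<open>auto simp: bij_mult_left bounded_linear.linear[OF mm.bounded_linear_right]
        intro!: bounded_linear.has_derivative[OF mm.bounded_linear_left f]\<close>)
  then have "((\<lambda>z. inv (\<lambda>X. f z ** X) (mat 1)) has_derivative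
    (\<lambda>v. - (matrix_inv (f x) ** f' v ** matrix_inv (f x)))) (at x)"
    by (simp add: inv_mult_left[OF inv] matrix_ring_simps)
  moreover have "eventually (\<lambda>z. inv (\<lambda>X. f z ** X) (mat 1) = matrix_inv (f z)) (at x)"
    using topological_tendstoD[OF isContD[OF cont] open_invertible] inv
    by (auto elim!: eventually_mono simp: inv_mult_left)
  ultimately show ?thesis
    by (rule has_derivative_transform_eventually) (simp_all add: inv inv_mult_left)
qed

section \<open>Smooth functions on open sets\<close>

lemma Ck_on_cong:
  assumes "open W" "\<And>x. x \<in> W \<Longrightarrow> f x = g x" "Ck_on k W f"
  shows "Ck_on k W g"
  using assms(2,3)
proof (induction k arbitrary: f g)
  case 0
  then show ?case using continuous_on_cong[of W W f g] by simp
next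
  case (Suc k)
  have der: "(g has_derivative frechet_derivative f (at x)) (at x)" if "x \<in> W" for x
    using Suc.prems that \<open>open W\<close>
    by (intro has_derivative_transform_within_open[of f _ x UNIV W g])
      (auto simp: frechet_derivative_works)
  then have eq: "frechet_derivative f (at x) = frechet_derivative g (at x)" if "x \<in> W" for x
    using that by (simp add: frechet_derivative_at)
  have "Ck_on k W (\<lambda>x. frechet_derivative g (at x) v)" for v
    by (rule Suc.IH[of "\<lambda>x. frechet_derivative f (at x) v"]) (use eq Suc.prems in auto)
  then show ?case using der by (auto simp: differentiable_def)
qed

text \<open>
  On an open set the Frechet derivative is determined by the function near the point, so it can be
  replaced by any formula \<open>f'\<close> for the derivative.
\<close>

lemma Ck_on_SucI:
  assumes "open W" "\<And>x. x \<in> W \<Longrightarrow> (f has_derivative f' x) (at x)" "\<And>v. Ck_on k W (\<lambda>x. f' x v)"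
  shows "Ck_on (Suc k) W f"
proof -
  have "Ck_on k W (\<lambda>x. frechet_derivative f (at x) v)" for v
    by (rule Ck_on_cong[OF assms(1) _ assms(3)[of v]]) (use assms(2) frechet_derivative_at in metis)
  then show ?thesis using assms(2) by (auto simp: differentiable_def)
qed

lemma Ck_on_Suc_D:
  assumes "Ck_on (Suc k) W f"
  shows "x \<in> W \<Longrightarrow> (f has_derivative frechet_derivative f (at x)) (at x)"
    and "Ck_on k W (\<lambda>x. frechet_derivative f (at x) v)"
  using assms by (auto simp: frechet_derivative_works)

lemma Ck_on_decrease: "Ck_on (Suc k) W f \<Longrightarrow> Ck_on k W f"
proof (induction k arbitrary: f)
  case 0
  then show ?case
    by (auto intro!: continuous_at_imp_continuous_on simp: differentiable_imp_continuous_within)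
next
  case (Suc k)
  then show ?case by auto
qed

lemma Ck_on_const: "open W \<Longrightarrow> Ck_on k W (\<lambda>_. c)"
proof (induction k arbitrary: c)
  case (Suc k)
  then show ?case by (intro Ck_on_SucI[where f' = "\<lambda>_ _. 0"]) auto
qed simp

lemma Ck_on_add: "open W \<Longrightarrow> Ck_on k W f \<Longrightarrow> Ck_on k W g \<Longrightarrow> Ck_on k W (\<lambda>x. f x + g x)"
proof (induction k arbitrary: f g)
  case (Suc k)
  note f = Ck_on_Suc_D[OF Suc.prems(2)] and g = Ck_on_Suc_D[OF Suc.prems(3)]
  show ?case
    by (rule Ck_on_SucI[where f' = "\<lambda>x v. frechet_derivative f (at x) v + frechet_derivative g (at x) v"])
      (use f g Suc in \<open>auto intro!: has_derivative_add\<close>)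
qed (auto intro: continuous_on_add)

lemma Ck_on_linear_compose:
  assumes L: "bounded_linear L"
  shows "open W \<Longrightarrow> Ck_on k W f \<Longrightarrow> Ck_on k W (\<lambda>x. L (f x))"
proof (induction k arbitrary: f)
  case 0
  then show ?case using bounded_linear.continuous_on[OF L] by simp
next
  case (Suc k)
  note f = Ck_on_Suc_D[OF Suc.prems(2)]
  show ?case
    by (rule Ck_on_SucI[where f' = "\<lambda>x v. L (frechet_derivative f (at x) v)"])
      (use f Suc in \<open>auto intro!: bounded_linear.has_derivative[OF L]\<close>)
qed

lemma Ck_on_ident: "open W \<Longrightarrow> Ck_on k W (\<lambda>x. x)"
proof (induction k)
  case (Suc k)
  then show ?case
    by (intro Ck_on_SucI[where f' = "\<lambda>_ v. v"]) (auto intro: Ck_on_const)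
qed simp

lemma Ck_on_bilinear:
  assumes B: "bounded_bilinear B"
  shows "open W \<Longrightarrow> Ck_on k W f \<Longrightarrow> Ck_on k W g \<Longrightarrow> Ck_on k W (\<lambda>x. B (f x) (g x))"
proof (induction k arbitrary: f g)
  case 0
  then show ?case using bounded_bilinear.continuous_on[OF B] by simp
next
  case (Suc k)
  note f = Ck_on_Suc_D[OF Suc.prems(2)] and g = Ck_on_Suc_D[OF Suc.prems(3)]
  show ?case
  proof (rule Ck_on_SucI)
    show "((\<lambda>x. B (f x) (g x)) has_derivative
      (\<lambda>v. B (f x) (frechet_derivative g (at x) v) + B (frechet_derivative f (at x) v) (g x))) (at x)"
      if "x \<in> W" for x
      using bounded_bilinear.FDERIV[OF B f(1)[OF that] g(1)[OF that]] .
  qed (intro Suc.prems Ck_on_add Suc.IH f(2) g(2) Ck_on_decrease)+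
qed

text \<open>
  The derivative of the inverse is a product of two inverses and the derivative of \<open>f\<close>. Hence its
  smoothness bootstraps from continuity.
\<close>

lemma Ck_on_matrix_inv:
  fixes f :: "'a::real_normed_vector \<Rightarrow> 'k::real_or_complex^'p::finite^'p"
  assumes W: "open W" and inv: "\<And>x. x \<in> W \<Longrightarrow> invertible (f x)"
  shows "Ck_on k W f \<Longrightarrow> Ck_on k W (\<lambda>x. matrix_inv (f x))"
proof (induction k)
  case 0
  have "continuous_on {P::'k^'p^'p. invertible P} matrix_inv"
    by (auto intro!: continuous_at_imp_continuous_on has_derivative_continuous has_derivative_matrix_inv
        has_derivative_ident)
  then show ?case
    using 0 inv by (auto intro: continuous_on_compose2)
next
  case (Suc k)
  note f = Ck_on_Suc_D[OF Suc.prems]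
  have IH: "Ck_on k W (\<lambda>x. matrix_inv (f x))" by (rule Suc.IH[OF Ck_on_decrease[OF Suc.prems]])
  show ?case
  proof (rule Ck_on_SucI[OF W])
    show "((\<lambda>x. matrix_inv (f x)) has_derivative
      (\<lambda>v. - (matrix_inv (f x) ** frechet_derivative f (at x) v ** matrix_inv (f x)))) (at x)"
      if "x \<in> W" for x
      using has_derivative_matrix_inv[OF f(1)[OF that] inv[OF that]] .
  qed (intro Ck_on_linear_compose[OF bounded_linear_minus[OF bounded_linear_ident]] W IH f(2)
      Ck_on_bilinear[OF bounded_bilinear_matrix_mult])
qed

section \<open>The metric\<close>

text \<open>
  With selectors in place of tuple patterns, the rules of differentiation apply to the base point
  \<open>Z\<close> as a variable.
\<close>

lemma metric_op_eq:
  "metric_op \<alpha>0 \<alpha>1 \<gamma>0 \<gamma>1 \<beta> Z w =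
    (\<alpha>0 *\<^sub>R fst w + (\<alpha>1 - \<alpha>0) *\<^sub>R (fst Z ** (fst Z)\<^sup>\<dagger> ** fst w),
     \<beta> *\<^sub>R (matrix_inv (fst (snd Z)) ** fst (snd w) ** matrix_inv (fst (snd Z))),
     \<gamma>0 *\<^sub>R snd (snd w) + (\<gamma>1 - \<gamma>0) *\<^sub>R (snd (snd Z) ** (snd (snd Z))\<^sup>\<dagger> ** snd (snd w)))"
  by (cases Z; cases w) simp

lemma linear_metric_op: "linear (metric_op \<alpha>0 \<alpha>1 \<gamma>0 \<gamma>1 \<beta> Z)"
  by (rule linearI) (simp_all add: metric_op_eq matrix_ring_simps algebra_simps)

text \<open>
  The projection \<open>U U\<^sup>\<dagger>\<close> splits the quadratic form of the Stiefel part into a multiple \<open>a\<close> on its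
  kernel and a multiple \<open>b\<close> on its range.
\<close>

lemma stiefel_form_pos:
  fixes U :: "'k::real_or_complex^'p::finite^'m::finite"
  assumes U: "U \<in> stiefel" and ab: "a > 0" "b > 0" and w: "w \<noteq> 0"
  shows "inner w (a *\<^sub>R w + (b - a) *\<^sub>R (U ** U\<^sup>\<dagger> ** w)) > 0"
proof -
  have UU: "U\<^sup>\<dagger> ** U = mat 1" using U by (simp add: stiefel_def)
  let ?x = "U\<^sup>\<dagger> ** w"
  have "inner w (U ** ?x) = inner ?x ?x"
    using inner_mult_left[of U ?x w] by (simp add: inner_commute)
  moreover have "inner (U ** ?x) (U ** ?x) = inner ?x ?x"
    using inner_mult_left[of U ?x "U ** ?x"] by (simp add: matrix_mul_assoc UU)
  ultimately have "inner w (a *\<^sub>R w + (b - a) *\<^sub>R (U ** ?x))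
    = a * inner (w - U ** ?x) (w - U ** ?x) + b * inner ?x ?x"
    by (simp add: inner_add_right inner_diff_left inner_diff_right inner_commute[of "U ** ?x" w]
        algebra_simps)
  also have "\<dots> > 0"
  proof (cases "?x = 0")
    case True
    then show ?thesis using ab w by (simp add: mm.zero_right)
  next
    case False
    then show ?thesis using ab by (simp add: add_nonneg_pos)
  qed
  finally show ?thesis by (simp add: matrix_mul_assoc)
qed

lemma pos_def_operator_metric_op:
  fixes Y :: "('k::real_or_complex, 'm::finite, 'n::finite, 'p::finite) ambient"
  assumes Y: "Y \<in> manif" and pos: "\<alpha>0 > 0" "\<alpha>1 > 0" "\<gamma>0 > 0" "\<gamma>1 > 0" "\<beta> > 0"
  shows "pos_def_operator (metric_op \<alpha>0 \<alpha>1 \<gamma>0 \<gamma>1 \<beta> Y)"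
  unfolding pos_def_operator_def inner_E_eq_inner
proof (intro conjI allI impI)
  obtain U P V where Y_eq: "Y = (U, P, V)" by (cases Y)
  with Y have U: "U \<in> stiefel" and P: "P \<in> pos_def_matrices" and V: "V \<in> stiefel"
    by (auto simp: manif_def)
  note posP = positive_op_conj(1)[OF P]
  have st: "inner (W ** W\<^sup>\<dagger> ** x) y = inner x (W ** W\<^sup>\<dagger> ** y)" for W :: "'k^'p^'r::finite" and x y
    using inner_mult_left[of "W ** W\<^sup>\<dagger>" x y] by simp
  show "linear (metric_op \<alpha>0 \<alpha>1 \<gamma>0 \<gamma>1 \<beta> Y)" by (rule linear_metric_op)
  fix a b :: "('k, 'm, 'n, 'p) ambient"
  show "inner (metric_op \<alpha>0 \<alpha>1 \<gamma>0 \<gamma>1 \<beta> Y a) b = inner a (metric_op \<alpha>0 \<alpha>1 \<gamma>0 \<gamma>1 \<beta> Y b)"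
    using posP by (cases a; cases b)
      (simp add: Y_eq inner_add_left inner_add_right st positive_op_def self_adjoint_def)
  assume "a \<noteq> 0"
  obtain aU aP aV where a: "a = (aU, aP, aV)" by (cases a)
  have nonneg: "inner aU (\<alpha>0 *\<^sub>R aU + (\<alpha>1 - \<alpha>0) *\<^sub>R (U ** U\<^sup>\<dagger> ** aU)) \<ge> 0"
    "inner aV (\<gamma>0 *\<^sub>R aV + (\<gamma>1 - \<gamma>0) *\<^sub>R (V ** V\<^sup>\<dagger> ** aV)) \<ge> 0"
    "inner aP (\<beta> *\<^sub>R (matrix_inv P ** aP ** matrix_inv P)) \<ge> 0"
    using stiefel_form_pos[OF U pos(1,2), of aU] stiefel_form_pos[OF V pos(3,4), of aV]
      positive_op_nonneg[OF posP, of aP] \<open>\<beta> > 0\<close>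
    by (cases "aU = 0"; cases "aV = 0"; simp)+
  from \<open>a \<noteq> 0\<close> consider "aU \<noteq> 0" | "aV \<noteq> 0" | "aP \<noteq> 0" by (auto simp: a zero_prod_def)
  then show "inner a (metric_op \<alpha>0 \<alpha>1 \<gamma>0 \<gamma>1 \<beta> Y a) > 0"
  proof cases
    case 1
    from stiefel_form_pos[OF U pos(1,2) this] nonneg show ?thesis by (simp add: Y_eq a)
  next
    case 2
    from stiefel_form_pos[OF V pos(3,4) this] nonneg show ?thesis by (simp add: Y_eq a)
  next
    case 3
    then have "inner aP (\<beta> *\<^sub>R (matrix_inv P ** aP ** matrix_inv P)) > 0"
      using posP \<open>\<beta> > 0\<close> by (simp add: positive_op_def)
    with nonneg show ?thesis by (simp add: Y_eq a)
  qed
qed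

lemma inner_product_on_pos_def_operator:
  assumes G: "pos_def_operator G" and S: "subspace S"
  shows "inner_product_on S (\<lambda>w w'. inner_E w (G w'))"
proof -
  have lin: "linear G" and sym: "\<And>x y. inner x (G y) = inner y (G x)"
    and pos: "\<And>x. x \<noteq> 0 \<Longrightarrow> inner x (G x) > 0"
    using G unfolding pos_def_operator_def inner_E_eq_inner by (metis inner_commute)+
  show ?thesis
    unfolding inner_product_on_def inner_E_eq_inner
    using S pos by (intro conjI ballI allI impI)
      (simp_all add: inner_add_left inner_add_right linear_add[OF lin] linear_scale[OF lin] sym)
qed

lemma subspace_tangent_space:
  "subspace (tangent_space (Y :: ('k::real_or_complex, 'm::finite, 'n::finite, 'p::finite) ambient))"
proof -
  obtain U P V where Y: "Y = (U, P, V)" by (cases Y)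
  have add: "W\<^sup>\<dagger> ** (x + y) + (x + y)\<^sup>\<dagger> ** W = (W\<^sup>\<dagger> ** x + x\<^sup>\<dagger> ** W) + (W\<^sup>\<dagger> ** y + y\<^sup>\<dagger> ** W)"
    and scale: "W\<^sup>\<dagger> ** (c *\<^sub>R x) + (c *\<^sub>R x)\<^sup>\<dagger> ** W = c *\<^sub>R (W\<^sup>\<dagger> ** x + x\<^sup>\<dagger> ** W)"
    for W x y :: "'k^'p^'r::finite" and c
    by (simp_all add: matrix_ring_simps algebra_simps)
  show ?thesis
    by (auto simp: Y subspace_def add scale zero_prod_def mm.zero_left mm.zero_right
        simp del: ktrans_linear_simps(1,4))
      (simp_all add: zero_prod_def[symmetric])
qed

lemma Ck_on_metric:
  fixes W :: "('k::real_or_complex, 'm::finite, 'n::finite, 'p::finite) ambient set"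
  assumes W: "open W" and inv: "\<And>U P V. (U, P, V) \<in> W \<Longrightarrow> invertible P"
  shows "Ck_on k W (\<lambda>Z. inner a (metric_op \<alpha>0 \<alpha>1 \<gamma>0 \<gamma>1 \<beta> Z b))"
proof -
  obtain aU aP aV bU bP bV where ab: "a = (aU, aP, aV)" "b = (bU, bP, bV)"
    by (cases a; cases b)
  have id: "Ck_on k W (\<lambda>Z. fst Z)" "Ck_on k W (\<lambda>Z. fst (snd Z))" "Ck_on k W (\<lambda>Z. snd (snd Z))"
    by (rule Ck_on_linear_compose[OF _ W Ck_on_ident[OF W]] bounded_linear_fst bounded_linear_snd
        bounded_linear_fst_comp bounded_linear_snd_comp)+
  have P: "Ck_on k W (\<lambda>Z. matrix_inv (fst (snd Z)))"
    using inv by (intro Ck_on_matrix_inv[OF W _ id(2)]) auto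
  note rules = Ck_on_add[OF W] Ck_on_const[OF W] W
    Ck_on_linear_compose[OF bounded_linear_inner_right W] Ck_on_linear_compose[OF bounded_linear_mult_right W]
    Ck_on_linear_compose[OF bounded_linear_scaleR_right W]
    Ck_on_bilinear[OF bounded_bilinear_matrix_mult W] Ck_on_linear_compose[OF bounded_linear_ktrans W] id P
  show ?thesis
    by (simp add: metric_op_eq ab) (intro rules)
qed

lemma riemannian_metric_on_metric_op:
  assumes pos: "\<alpha>0 > 0" "\<alpha>1 > 0" "\<gamma>0 > 0" "\<gamma>1 > 0" "\<beta> > 0"
  shows "riemannian_metric_on (manif :: ('k::real_or_complex, 'm::finite, 'n::finite, 'p::finite) ambient set)
    tangent_space (\<lambda>Y w w'. inner_E w (metric_op \<alpha>0 \<alpha>1 \<gamma>0 \<gamma>1 \<beta> Y w'))"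
  unfolding riemannian_metric_on_def
proof (intro conjI ballI)
  fix Y :: "('k, 'm, 'n, 'p) ambient" assume Y: "Y \<in> manif"
  show "inner_product_on (tangent_space Y) (\<lambda>w w'. inner_E w (metric_op \<alpha>0 \<alpha>1 \<gamma>0 \<gamma>1 \<beta> Y w'))"
    by (rule inner_product_on_pos_def_operator[OF pos_def_operator_metric_op[OF Y pos] subspace_tangent_space])
  \<comment> \<open>The formula for the metric is its own smooth extension, to the open set where \<open>P\<close> is invertible.\<close>
  define W :: "('k, 'm, 'n, 'p) ambient set" where "W = UNIV \<times> {P. invertible P} \<times> UNIV"
  let ?G = "\<lambda>Z w w'. inner w (metric_op \<alpha>0 \<alpha>1 \<gamma>0 \<gamma>1 \<beta> Z w')"
  have W: "open W" by (auto simp: W_def intro: open_Times open_invertible)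
  have inv: "\<And>U P V. (U, P, V) \<in> W \<Longrightarrow> invertible P" by (simp add: W_def)
  have "Y \<in> W" using Y pos_def_invertible by (auto simp: W_def manif_def)
  moreover have "bilinear (?G Z)" for Z :: "('k, 'm, 'n, 'p) ambient"
    by (auto simp: bilinear_def linear_iff inner_add_left inner_add_right
        linear_add[OF linear_metric_op] linear_scale[OF linear_metric_op])
  moreover have "smooth_on_open W (\<lambda>Z. ?G Z a b)" for a b
    unfolding smooth_on_open_def by (intro allI Ck_on_metric[OF W inv])
  ultimately show "\<exists>W G. open W \<and> Y \<in> W \<and> (\<forall>z\<in>W. bilinear (G z)) \<and>
      (\<forall>a b. smooth_on_open W (\<lambda>z. G z a b)) \<and>
      (\<forall>z\<in>manif \<inter> W. \<forall>a\<in>tangent_space z. \<forall>b\<in>tangent_space z.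
         G z a b = inner_E a (metric_op \<alpha>0 \<alpha>1 \<gamma>0 \<gamma>1 \<beta> z b))"
    using W by (intro exI[of _ W] exI[of _ ?G]) (simp add: inner_E_eq_inner)
qed

section \<open>The Christoffel metric term\<close>

lemmas matrix_derivative_intros =
  mm.FDERIV bounded_linear.has_derivative[OF bounded_linear_ktrans] has_derivative_matrix_inv
  has_derivative_Pair has_derivative_fst has_derivative_snd has_derivative_ident has_derivative_const
  has_derivative_add has_derivative_diff has_derivative_minus has_derivative_scaleR_right

lemma has_derivative_metric_op:
  fixes Y :: "('k::real_or_complex, 'm::finite, 'n::finite, 'p::finite) ambient"
  assumes Y: "Y = (U, P, V)" and inv: "invertible P"
  defines "Q \<equiv> matrix_inv P"
  shows "((\<lambda>Z. metric_op \<alpha>0 \<alpha>1 \<gamma>0 \<gamma>1 \<beta> Z (wU, wP, wV)) has_derivative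
    (\<lambda>(vU, vP, vV). ((\<alpha>1 - \<alpha>0) *\<^sub>R ((vU ** U\<^sup>\<dagger> + U ** vU\<^sup>\<dagger>) ** wU),
       - \<beta> *\<^sub>R (Q ** vP ** Q ** wP ** Q + Q ** wP ** Q ** vP ** Q),
       (\<gamma>1 - \<gamma>0) *\<^sub>R ((vV ** V\<^sup>\<dagger> + V ** vV\<^sup>\<dagger>) ** wV)))) (at Y)"
  unfolding metric_op_eq
  by (rule has_derivative_eq_rhs, (rule matrix_derivative_intros | simp add: Y inv)+)
    (auto simp: fun_eq_iff Y Q_def matrix_ring_simps algebra_simps)

lemma is_cross_term_unique:
  assumes "is_cross_term g Y \<xi> \<eta> x" "is_cross_term g Y \<xi> \<eta> y"
  shows "x = y"
proof -
  have "inner x \<phi> = inner y \<phi>" for \<phi>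
    using assms unfolding is_cross_term_def inner_E_eq_inner by metis
  then show ?thesis by (metis vector_eq_rdot)
qed

text \<open>
  The cross term takes the adjoint of the derivative of the metric in its direction. This moves
  every factor that stands next to the direction to the other side of the inner product.
\<close>

lemma is_cross_term_metric_op:
  fixes U :: "'k::real_or_complex^'p::finite^'m::finite" and V :: "'k^'p^'n::finite"
  assumes P: "P \<in> pos_def_matrices" and \<eta>: "\<eta>P\<^sup>\<dagger> = \<eta>P" and \<xi>: "\<xi>P\<^sup>\<dagger> = \<xi>P"
  defines "Q \<equiv> matrix_inv P"
  shows "is_cross_term (metric_op \<alpha>0 \<alpha>1 \<gamma>0 \<gamma>1 \<beta>) (U, P, V) (\<eta>U, \<eta>P, \<eta>V) (\<xi>U, \<xi>P, \<xi>V)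
    ((\<alpha>1 - \<alpha>0) *\<^sub>R ((\<eta>U ** \<xi>U\<^sup>\<dagger> + \<xi>U ** \<eta>U\<^sup>\<dagger>) ** U),
     - \<beta> *\<^sub>R (Q ** \<eta>P ** Q ** \<xi>P ** Q + Q ** \<xi>P ** Q ** \<eta>P ** Q),
     (\<gamma>1 - \<gamma>0) *\<^sub>R ((\<eta>V ** \<xi>V\<^sup>\<dagger> + \<xi>V ** \<eta>V\<^sup>\<dagger>) ** V))"
proof -
  have Q: "Q\<^sup>\<dagger> = Q"
    unfolding Q_def by (rule ktrans_matrix_inv[OF pos_def_invertible[OF P] pos_def_ktrans[OF P]])
  have st: "inner ((x ** y\<^sup>\<dagger> + y ** x\<^sup>\<dagger>) ** W) v = inner ((v ** W\<^sup>\<dagger> + W ** v\<^sup>\<dagger>) ** x) y"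
    for W v x y :: "'k^'p^'r::finite"
  proof -
    have "inner (x ** y\<^sup>\<dagger> ** W) v = inner (W ** v\<^sup>\<dagger> ** x) y"
      using inner_ktrans_ktrans[of "x ** (y\<^sup>\<dagger> ** W)" v] inner_mult_right[of "W\<^sup>\<dagger> ** y" "x\<^sup>\<dagger>" "v\<^sup>\<dagger>"]
        inner_mult_left[of "W\<^sup>\<dagger>" y "v\<^sup>\<dagger> ** x"]
      by (simp add: matrix_mul_assoc inner_commute)
    moreover have "inner (y ** x\<^sup>\<dagger> ** W) v = inner (v ** W\<^sup>\<dagger> ** x) y"
      using inner_mult_right[of y "x\<^sup>\<dagger> ** W" v] by (simp add: matrix_mul_assoc inner_commute)
    ultimately show ?thesis by (simp add: matrix_ring_simps inner_add_left)
  qed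
  have "(Q ** \<eta>P ** Q)\<^sup>\<dagger> = Q ** \<eta>P ** Q" "(Q ** \<xi>P ** Q)\<^sup>\<dagger> = Q ** \<xi>P ** Q"
    by (simp_all add: Q \<eta> \<xi> matrix_mul_assoc)
  then have "inner (Q ** \<eta>P ** Q ** \<xi>P ** Q) v = inner (Q ** \<eta>P ** Q ** v ** Q) \<xi>P"
    "inner (Q ** \<xi>P ** Q ** \<eta>P ** Q) v = inner (Q ** v ** Q ** \<eta>P ** Q) \<xi>P" for v
    using inner_mult_both[of "Q ** \<eta>P ** Q" Q v \<xi>P] inner_mult_both[of Q "Q ** \<eta>P ** Q" v \<xi>P] Q
    by (simp_all add: matrix_mul_assoc inner_commute)
  then show ?thesis
    unfolding is_cross_term_def inner_E_eq_inner dirderiv_def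
      frechet_derivative_at[OF has_derivative_metric_op[OF refl pos_def_invertible[OF P]], symmetric]
    by (simp add: st Q_def[symmetric] inner_add_left)
qed

lemma christoffel_metric_op:
  fixes U :: "'k::real_or_complex^'p::finite^'m::finite" and V :: "'k^'p^'n::finite"
  assumes Y: "(U, P, V) \<in> manif"
    and \<eta>: "(\<eta>U, \<eta>P, \<eta>V) \<in> tangent_space (U, P, V)"
    and \<xi>: "(\<xi>U, \<xi>P, \<xi>V) \<in> tangent_space (U, P, V)"
  shows "christoffel (metric_op \<alpha>0 \<alpha>1 \<gamma>0 \<gamma>1 \<beta>) (U, P, V) (\<eta>U, \<eta>P, \<eta>V) (\<xi>U, \<xi>P, \<xi>V) =
    ((\<alpha>1 - \<alpha>0) *\<^sub>R (U ** sym_t (\<eta>U\<^sup>\<dagger> ** \<xi>U) - (\<eta>U ** \<xi>U\<^sup>\<dagger> + \<xi>U ** \<eta>U\<^sup>\<dagger>) ** U),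
     - \<beta> *\<^sub>R sym_t (matrix_inv P ** \<eta>P ** matrix_inv P ** \<xi>P ** matrix_inv P),
     (\<gamma>1 - \<gamma>0) *\<^sub>R (V ** sym_t (\<eta>V\<^sup>\<dagger> ** \<xi>V) - (\<eta>V ** \<xi>V\<^sup>\<dagger> + \<xi>V ** \<eta>V\<^sup>\<dagger>) ** V))"
proof -
  from Y have P: "P \<in> pos_def_matrices" by (simp add: manif_def)
  from \<eta> \<xi> have herm: "\<eta>P\<^sup>\<dagger> = \<eta>P" "\<xi>P\<^sup>\<dagger> = \<xi>P" by auto
  let ?g = "metric_op \<alpha>0 \<alpha>1 \<gamma>0 \<gamma>1 \<beta>" and ?Q = "matrix_inv P"
  have Q: "?Q\<^sup>\<dagger> = ?Q" by (rule ktrans_matrix_inv[OF pos_def_invertible[OF P] pos_def_ktrans[OF P]])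
  note cross = is_cross_term_metric_op[OF P herm]
  note der = has_derivative_metric_op[OF refl pos_def_invertible[OF P]]
  have X: "(THE x. is_cross_term ?g (U, P, V) (\<eta>U, \<eta>P, \<eta>V) (\<xi>U, \<xi>P, \<xi>V) x) =
    ((\<alpha>1 - \<alpha>0) *\<^sub>R ((\<eta>U ** \<xi>U\<^sup>\<dagger> + \<xi>U ** \<eta>U\<^sup>\<dagger>) ** U),
     - \<beta> *\<^sub>R (?Q ** \<eta>P ** ?Q ** \<xi>P ** ?Q + ?Q ** \<xi>P ** ?Q ** \<eta>P ** ?Q),
     (\<gamma>1 - \<gamma>0) *\<^sub>R ((\<eta>V ** \<xi>V\<^sup>\<dagger> + \<xi>V ** \<eta>V\<^sup>\<dagger>) ** V))"
    by (rule the_equality, rule cross, erule is_cross_term_unique[OF _ cross])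
  \<comment> \<open>Tangency \<open>W\<^sup>\<dagger> x = - x\<^sup>\<dagger> W\<close> turns the terms \<open>x W\<^sup>\<dagger> y\<close> into the same shape as the cross term.\<close>
  have half: "(1/2) *\<^sub>R (c *\<^sub>R (- A + p) + c *\<^sub>R (- B + q) - c *\<^sub>R (A + B))
      = c *\<^sub>R ((1/2) *\<^sub>R (p + q) - (A + B))" for c and A B p q :: "'b::real_vector"
  proof -
    have "c *\<^sub>R (- A + p) + c *\<^sub>R (- B + q) - c *\<^sub>R (A + B) = c *\<^sub>R ((p + q) - ((A + B) + (A + B)))"
      by (simp add: algebra_simps)
    moreover have "(1/2) *\<^sub>R ((p + q) - ((A + B) + (A + B))) = (1/2) *\<^sub>R (p + q) - (A + B)"
      by (simp only: scaleR_right_diff_distrib scaleR_half_double)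
    ultimately show ?thesis by (metis scaleR_left_commute)
  qed
  have st: "(1/2) *\<^sub>R (c *\<^sub>R ((x ** W\<^sup>\<dagger> + W ** x\<^sup>\<dagger>) ** y) + c *\<^sub>R ((y ** W\<^sup>\<dagger> + W ** y\<^sup>\<dagger>) ** x)
      - c *\<^sub>R ((x ** y\<^sup>\<dagger> + y ** x\<^sup>\<dagger>) ** W))
    = c *\<^sub>R (W ** sym_t (x\<^sup>\<dagger> ** y) - (x ** y\<^sup>\<dagger> + y ** x\<^sup>\<dagger>) ** W)"
    if "W\<^sup>\<dagger> ** x + x\<^sup>\<dagger> ** W = 0" "W\<^sup>\<dagger> ** y + y\<^sup>\<dagger> ** W = 0" for c and W x y :: "'k^'p^'r::finite"
  proof -
    have "W\<^sup>\<dagger> ** x = - (x\<^sup>\<dagger> ** W)" "W\<^sup>\<dagger> ** y = - (y\<^sup>\<dagger> ** W)"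
      using that by (simp_all add: eq_neg_iff_add_eq_0)
    then have *: "y ** W\<^sup>\<dagger> ** x = - (y ** x\<^sup>\<dagger> ** W)" "x ** W\<^sup>\<dagger> ** y = - (x ** y\<^sup>\<dagger> ** W)"
      by (simp_all add: matrix_mul_assoc[symmetric] mm.minus_right)
    show ?thesis
      unfolding matrix_ring_simps sym_t_def ktrans_mult ktrans_ktrans * by (rule half)
  qed
  show ?thesis
    unfolding christoffel_def X dirderiv_def frechet_derivative_at[OF der, symmetric]
      prod.case scaleR_Pair add_Pair diff_Pair prod.inject
  proof (intro conjI st)
    show "(1/2) *\<^sub>R (- \<beta> *\<^sub>R (?Q ** \<eta>P ** ?Q ** \<xi>P ** ?Q + ?Q ** \<xi>P ** ?Q ** \<eta>P ** ?Q)
        + - \<beta> *\<^sub>R (?Q ** \<xi>P ** ?Q ** \<eta>P ** ?Q + ?Q ** \<eta>P ** ?Q ** \<xi>P ** ?Q)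
        - - \<beta> *\<^sub>R (?Q ** \<eta>P ** ?Q ** \<xi>P ** ?Q + ?Q ** \<xi>P ** ?Q ** \<eta>P ** ?Q))
      = - \<beta> *\<^sub>R sym_t (?Q ** \<eta>P ** ?Q ** \<xi>P ** ?Q)"
      by (simp only: sym_t_def herm Q ktrans_mult matrix_mul_assoc
          add.commute[of "?Q ** \<xi>P ** ?Q ** \<eta>P ** ?Q"] add_diff_cancel_right' scaleR_left_commute)
  qed (use \<eta> \<xi> in auto)
qed

section \<open>Orbits and the horizontal space\<close>

lemma has_derivative_act:
  fixes U :: "'k::real_or_complex^'p::finite^'m::finite" and V :: "'k^'p^'n::finite"
    and Q :: "real \<Rightarrow> 'k^'p^'p"
  assumes Q: "(Q has_derivative (\<lambda>t. t *\<^sub>R a)) (at 0)" "Q 0 = mat 1"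
  shows "((\<lambda>t. act (Q t) (U, P, V)) has_derivative
    (\<lambda>t. t *\<^sub>R (U ** a\<^sup>\<dagger>, a ** P + P ** a\<^sup>\<dagger>, V ** a\<^sup>\<dagger>))) (at 0)"
  unfolding act.simps
  by (rule has_derivative_eq_rhs, (rule matrix_derivative_intros Q)+)
    (simp add: fun_eq_iff Q(2) matrix_ring_simps algebra_simps)

text \<open>
  The Cayley transform \<open>(1 + t a / 2) (1 - t a / 2)\<^sup>-\<^sup>1\<close> of a skew matrix is a curve in the unitary group
  with velocity \<open>a\<close>. The inverse exists because a skew matrix has no nonzero real eigenvalue.
\<close>

lemma unitary_curve_with_velocity:
  fixes a :: "'k::real_or_complex^'p::finite^'p"
  assumes a: "a\<^sup>\<dagger> = - a"
  obtains Q :: "real \<Rightarrow> 'k^'p^'p"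
  where "\<And>t. Q t \<in> unitary_matrices" "Q 0 = mat 1" "(Q has_derivative (\<lambda>t. t *\<^sub>R a)) (at 0)"
proof -
  define N where "N t = mat 1 - (t/2) *\<^sub>R a" for t
  have adjN: "(N t)\<^sup>\<dagger> = mat 1 + (t/2) *\<^sub>R a" for t by (simp add: N_def a)
  have inv: "invertible (N t)" for t
  proof -
    have lin: "linear (\<lambda>X::'k^'p^'p. N t ** X)"
      by (rule bounded_linear.linear[OF mm.bounded_linear_right])
    have "X = 0" if "N t ** X = 0" for X :: "'k^'p^'p"
    proof -
      have "X = (t/2) *\<^sub>R (a ** X)" using that by (simp add: N_def matrix_ring_simps)
      then have "inner X X = t/2 * inner X (a ** X)" by (metis inner_scaleR_right)
      moreover have "inner X (a ** X) = 0"
        using inner_mult_left[of a X X] by (simp add: a mm.minus_left inner_commute)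
      ultimately show "X = 0" by simp
    qed
    then have "inj (\<lambda>X::'k^'p^'p. N t ** X)" by (auto simp: linear_injective_0[OF lin])
    then have "bij (\<lambda>X::'k^'p^'p. N t ** X)"
      using linear_injective_imp_surjective[OF lin] by (simp add: bij_def)
    then show ?thesis by (simp add: bij_mult_left)
  qed
  define Q where "Q t = (N t)\<^sup>\<dagger> ** matrix_inv (N t)" for t
  have N0: "N 0 = mat 1" by (simp add: N_def)
  have mat1: "matrix_inv (mat 1 :: 'k^'p^'p) = mat 1" by (rule matrix_inv_mult(3)) simp_all
  have "Q t \<in> unitary_matrices" for t
  proof -
    have "(mat 1 - b) ** (mat 1 + b) = (mat 1 + b) ** (mat 1 - b)" for b :: "'k^'p^'p"
      by (simp add: matrix_ring_simps algebra_simps)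
    then have comm: "N t ** (N t)\<^sup>\<dagger> = (N t)\<^sup>\<dagger> ** N t"
      unfolding adjN unfolding N_def by blast
    have "(Q t)\<^sup>\<dagger> ** Q t = (matrix_inv (N t))\<^sup>\<dagger> ** (N t ** (N t)\<^sup>\<dagger>) ** matrix_inv (N t)"
      by (simp add: Q_def matrix_mul_assoc)
    also have "\<dots> = (N t ** matrix_inv (N t))\<^sup>\<dagger> ** (N t ** matrix_inv (N t))"
      by (simp add: comm matrix_mul_assoc)
    finally have "(Q t)\<^sup>\<dagger> ** Q t = mat 1" by (simp add: matrix_inv_simps[OF inv])
    then show ?thesis by (simp add: unitary_matrices_def matrix_left_right_inverse)
  qed
  moreover have "Q 0 = mat 1" by (simp add: Q_def N0 mat1)
  moreover have "(Q has_derivative (\<lambda>t. t *\<^sub>R a)) (at 0)"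
  proof -
    have N': "(N has_derivative (\<lambda>t. - ((t/2) *\<^sub>R a))) (at 0)"
      unfolding N_def[abs_def] by (auto intro!: derivative_eq_intros)
    show ?thesis
      unfolding Q_def[abs_def]
      by (rule has_derivative_eq_rhs, (rule matrix_derivative_intros N' inv)+)
        (simp add: fun_eq_iff N0 mat1 matrix_ring_simps a scaleR_add_left[symmetric])
  qed
  ultimately show ?thesis using that by blast
qed

lemma velocities_orbit:
  fixes U :: "'k::real_or_complex^'p::finite^'m::finite" and V :: "'k^'p^'n::finite"
  assumes U: "U \<in> stiefel"
  shows "velocities (orbit (U, P, V)) (U, P, V) = {(- (U ** a), a ** P - P ** a, - (V ** a)) | a. a\<^sup>\<dagger> = - a}"
    (is "_ = ?R")
proof (intro equalityI subsetI)
  fix v assume "v \<in> velocities (orbit (U, P, V)) (U, P, V)"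
  then obtain c where c: "\<And>t. c t \<in> orbit (U, P, V)" "c 0 = (U, P, V)"
    and v: "(c has_derivative (\<lambda>t. t *\<^sub>R v)) (at 0)"
    by (auto simp: velocities_def has_vector_derivative_def)
  have "\<exists>Q. c t = act Q (U, P, V) \<and> Q \<in> unitary_matrices" for t
    using c(1)[of t] by (auto simp: orbit_def)
  then obtain Q where Q: "\<And>t. c t = act (Q t) (U, P, V)" "\<And>t. Q t \<in> unitary_matrices" by metis
  have UU: "U\<^sup>\<dagger> ** U = mat 1" using U by (simp add: stiefel_def)
  \<comment> \<open>The group element, and with it the smoothness of its motion, is recovered from the curve
    because \<open>U\<close> has a left inverse.\<close>
  have Q_eq: "Q t = (U\<^sup>\<dagger> ** fst (c t))\<^sup>\<dagger>" for t
    by (simp add: Q(1) matrix_mul_assoc UU)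
  have Q0: "Q 0 = mat 1" by (simp add: Q_eq c(2) UU)
  define a where "a = (U\<^sup>\<dagger> ** fst v)\<^sup>\<dagger>"
  have Q': "(Q has_derivative (\<lambda>t. t *\<^sub>R a)) (at 0)"
    unfolding Q_eq[abs_def]
    by (rule has_derivative_eq_rhs, (rule matrix_derivative_intros v)+)
      (simp add: fun_eq_iff a_def matrix_ring_simps)
  have "((\<lambda>t. (Q t)\<^sup>\<dagger> ** Q t) has_derivative (\<lambda>t. t *\<^sub>R (a\<^sup>\<dagger> + a))) (at 0)"
    by (rule has_derivative_eq_rhs, (rule matrix_derivative_intros Q')+)
      (simp add: fun_eq_iff Q0 matrix_ring_simps algebra_simps)
  moreover have "(\<lambda>t. (Q t)\<^sup>\<dagger> ** Q t) = (\<lambda>t. mat 1)" using Q(2) by (simp add: unitary_matrices_def)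
  ultimately have "(\<lambda>t. t *\<^sub>R (a\<^sup>\<dagger> + a)) = (\<lambda>t::real. 0)"
    by (metis has_derivative_const has_derivative_unique)
  from fun_cong[OF this, of 1] have a: "a\<^sup>\<dagger> = - a" by (simp add: eq_neg_iff_add_eq_0)
  have "c = (\<lambda>t. act (Q t) (U, P, V))" using Q(1) by blast
  with v has_derivative_act[OF Q' Q0, of U P V]
  have "(\<lambda>t. t *\<^sub>R v) = (\<lambda>t. t *\<^sub>R (U ** a\<^sup>\<dagger>, a ** P + P ** a\<^sup>\<dagger>, V ** a\<^sup>\<dagger>))"
    using has_derivative_unique by blast
  from fun_cong[OF this, of 1] show "v \<in> ?R"
    using a by (auto simp: mm.minus_right intro!: exI[of _ a])
next
  fix v assume "v \<in> ?R"
  then obtain a where a: "a\<^sup>\<dagger> = - a" and v: "v = (- (U ** a), a ** P - P ** a, - (V ** a))" by blast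
  obtain Q where Q: "\<And>t. Q t \<in> unitary_matrices" "Q 0 = mat 1" "(Q has_derivative (\<lambda>t. t *\<^sub>R a)) (at 0)"
    using unitary_curve_with_velocity[OF a] by blast
  from has_derivative_act[OF Q(3,2), of U P V]
  have "((\<lambda>t. act (Q t) (U, P, V)) has_vector_derivative v) (at 0)"
    by (simp add: has_vector_derivative_def v a mm.minus_right)
  with Q(1,2) show "v \<in> velocities (orbit (U, P, V)) (U, P, V)"
    by (auto simp: velocities_def orbit_def intro!: exI[of _ "\<lambda>t. act (Q t) (U, P, V)"])
qed

text \<open>
  Pairing the orbit velocity of a skew matrix \<open>a\<close> with a tangent vector \<open>h\<close> gives, up to sign, the inner
  product of \<open>a\<close> with the difference of the two sides of the equation below, which is itself skew.
\<close>

lemma horizontal_space_iff: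
  fixes U :: "'k::real_or_complex^'p::finite^'m::finite" and V :: "'k^'p^'n::finite"
  assumes Y: "(U, P, V) \<in> manif"
  shows "(hU, hP, hV) \<in> horizontal_space (metric_op \<alpha>0 \<alpha>1 \<gamma>0 \<gamma>1 \<beta>) (U, P, V) \<longleftrightarrow>
    (hU, hP, hV) \<in> tangent_space (U, P, V) \<and>
    \<alpha>1 *\<^sub>R (U\<^sup>\<dagger> ** hU) + \<gamma>1 *\<^sub>R (V\<^sup>\<dagger> ** hV) = \<beta> *\<^sub>R (matrix_inv P ** hP - hP ** matrix_inv P)"
proof -
  let ?Q = "matrix_inv P"
  from Y have P: "P \<in> pos_def_matrices" and UV: "U \<in> stiefel" "V \<in> stiefel" by (auto simp: manif_def)
  note inv = matrix_inv_simps[OF pos_def_invertible[OF P]]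
  have herm: "P\<^sup>\<dagger> = P" "?Q\<^sup>\<dagger> = ?Q"
    using pos_def_ktrans[OF P] ktrans_matrix_inv[OF pos_def_invertible[OF P]] by auto
  define K where "K = \<alpha>1 *\<^sub>R (U\<^sup>\<dagger> ** hU) + \<gamma>1 *\<^sub>R (V\<^sup>\<dagger> ** hV) - \<beta> *\<^sub>R (?Q ** hP - hP ** ?Q)"
  have st: "inner (- (W ** a)) (c *\<^sub>R h + (d - c) *\<^sub>R (W ** W\<^sup>\<dagger> ** h)) = - (d * inner a (W\<^sup>\<dagger> ** h))"
    if "W \<in> stiefel" for c d a h and W :: "'k^'p^'r::finite"
  proof -
    have "W\<^sup>\<dagger> ** W = mat 1" using that by (simp add: stiefel_def)
    then have "W\<^sup>\<dagger> ** (c *\<^sub>R h + (d - c) *\<^sub>R (W ** W\<^sup>\<dagger> ** h)) = d *\<^sub>R (W\<^sup>\<dagger> ** h)"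
      by (simp add: matrix_ring_simps algebra_simps)
    then show ?thesis by (simp add: inner_mult_left)
  qed
  have pairP: "inner (a ** P - P ** a) (\<beta> *\<^sub>R (?Q ** hP ** ?Q)) = \<beta> * inner a (?Q ** hP - hP ** ?Q)" for a
    using inner_mult_right[of a P "?Q ** hP ** ?Q"] inner_mult_left[of P a "?Q ** hP ** ?Q"]
    by (simp add: inner_diff_left inner_diff_right herm matrix_mul_assoc inv)
  have pair: "inner (- (U ** a), a ** P - P ** a, - (V ** a)) (metric_op \<alpha>0 \<alpha>1 \<gamma>0 \<gamma>1 \<beta> (U, P, V) (hU, hP, hV))
      = - inner a K" for a
    unfolding metric_op.simps inner_Pair st[OF UV(1)] st[OF UV(2)] pairP
    by (simp add: K_def inner_add_right inner_diff_right)
  have skew: "K\<^sup>\<dagger> = - K" if h: "(hU, hP, hV) \<in> tangent_space (U, P, V)"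
  proof -
    from h have "(U\<^sup>\<dagger> ** hU)\<^sup>\<dagger> = - (U\<^sup>\<dagger> ** hU)" "(V\<^sup>\<dagger> ** hV)\<^sup>\<dagger> = - (V\<^sup>\<dagger> ** hV)" "hP\<^sup>\<dagger> = hP"
      by (simp_all add: eq_neg_iff_add_eq_0 add.commute)
    then show ?thesis
      by (simp add: K_def herm algebra_simps del: ktrans_mult) (simp add: herm)
  qed
  have "(\<forall>a. a\<^sup>\<dagger> = - a \<longrightarrow> inner a K = 0) \<longleftrightarrow> K = 0" if "K\<^sup>\<dagger> = - K"
    using that by (metis inner_eq_zero_iff inner_zero_right)
  moreover have "K = 0 \<longleftrightarrow> \<alpha>1 *\<^sub>R (U\<^sup>\<dagger> ** hU) + \<gamma>1 *\<^sub>R (V\<^sup>\<dagger> ** hV) = \<beta> *\<^sub>R (?Q ** hP - hP ** ?Q)"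
    by (simp add: K_def)
  moreover have "(hU, hP, hV) \<in> horizontal_space (metric_op \<alpha>0 \<alpha>1 \<gamma>0 \<gamma>1 \<beta>) (U, P, V) \<longleftrightarrow>
    (hU, hP, hV) \<in> tangent_space (U, P, V) \<and> (\<forall>a. a\<^sup>\<dagger> = - a \<longrightarrow> inner a K = 0)"
    unfolding horizontal_space_def velocities_orbit[OF UV(1)] inner_E_eq_inner
    using pair by fastforce
  ultimately show ?thesis using skew by blast
qed

lemma subspace_horizontal_space: "subspace (horizontal_space (metric_op \<alpha>0 \<alpha>1 \<gamma>0 \<gamma>1 \<beta>) Y)"
  unfolding horizontal_space_def inner_E_eq_inner
  using subspace_tangent_space[of Y]
  by (auto simp: subspace_def linear_0[OF linear_metric_op] linear_add[OF linear_metric_op]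
      linear_scale[OF linear_metric_op] inner_add_right)

section \<open>The horizontal projection\<close>

lemma is_orth_proj_unique:
  assumes G: "pos_def_operator G" and H: "subspace H"
    and h: "is_orth_proj G H w h" and h': "is_orth_proj G H w h'"
  shows "h = h'"
proof (rule ccontr)
  have lin: "linear G" and pos: "\<And>x. x \<noteq> 0 \<Longrightarrow> inner x (G x) > 0"
    using G unfolding pos_def_operator_def inner_E_eq_inner by metis+
  assume "h \<noteq> h'"
  then have "inner (h - h') (G (h - h')) > 0" using pos[of "h - h'"] by simp
  moreover have "h - h' \<in> H" using h h' H by (auto simp: is_orth_proj_def subspace_diff)
  then have "inner (h - h') (G (w - h')) = 0" "inner (h - h') (G (w - h)) = 0"
    using h h' by (simp_all add: is_orth_proj_def inner_E_eq_inner)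
  ultimately show False by (simp add: linear_diff[OF lin] inner_diff_right)
qed

text \<open>
  Writing \<open>x\<close>, \<open>y\<close> and \<open>q\<close> for \<open>U\<^sup>\<dagger> v\<^sub>U\<close>, \<open>V\<^sup>\<dagger> v\<^sub>V\<close> and \<open>v\<^sub>P\<close> of a horizontal vector \<open>v\<close>, the pairing of \<open>v\<close>
  with the residual of the projection depends on \<open>x - y\<close>, which is arbitrary skew, and on \<open>q\<close>, which
  determines \<open>\<alpha>1 x + \<gamma>1 y\<close>. The skew matrix \<open>D_minus\<close> is chosen to cancel the first contribution,
  and the equation that defines \<open>D_plus\<close> says that the second one vanishes.
\<close>

lemma is_orth_proj_proj_formula:
  fixes U :: "'k::real_or_complex^'p::finite^'m::finite" and V :: "'k^'p^'n::finite"
  assumes Y: "(U, P, V) \<in> manif" and pos: "\<alpha>1 > 0" "\<gamma>1 > 0" "\<beta> > 0" and \<delta>: "\<delta> = \<alpha>1 + \<gamma>1"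
  shows "is_orth_proj (metric_op \<alpha>0 \<alpha>1 \<gamma>0 \<gamma>1 \<beta> (U, P, V))
    (horizontal_space (metric_op \<alpha>0 \<alpha>1 \<gamma>0 \<gamma>1 \<beta>) (U, P, V)) \<omega> (proj_formula \<alpha>1 \<gamma>1 \<beta> \<delta> (U, P, V) \<omega>)"
proof -
  obtain wU wP wV where \<omega>: "\<omega> = (wU, wP, wV)" by (cases \<omega>)
  let ?Q = "matrix_inv P" and ?g = "metric_op \<alpha>0 \<alpha>1 \<gamma>0 \<gamma>1 \<beta>"
  from Y have P: "P \<in> pos_def_matrices" and UU: "U\<^sup>\<dagger> ** U = mat 1" and VV: "V\<^sup>\<dagger> ** V = mat 1"
    by (auto simp: manif_def stiefel_def)
  note inv = matrix_inv_simps[OF pos_def_invertible[OF P]]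
  have herm: "P\<^sup>\<dagger> = P" "?Q\<^sup>\<dagger> = ?Q"
    using pos_def_ktrans[OF P] ktrans_matrix_inv[OF pos_def_invertible[OF P]] by auto
  have "\<delta> > 0" using pos \<delta> by simp
  define Dm where "Dm = D_minus \<delta> (U, P, V) \<omega>"
  define Dp where "Dp = D_plus \<alpha>1 \<gamma>1 \<beta> \<delta> (U, P, V) \<omega>"
  define B where "B = (1/\<delta>) *\<^sub>R (?Q ** Dp - Dp ** ?Q)"
  define sU where "sU = U\<^sup>\<dagger> ** wU"
  define sV where "sV = V\<^sup>\<dagger> ** wV"
  define XU where "XU = - \<gamma>1 *\<^sub>R Dm + B"
  define XV where "XV = \<alpha>1 *\<^sub>R Dm + B"
  define hU where "hU = U ** XU + wU - U ** U\<^sup>\<dagger> ** wU"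
  define hV where "hV = V ** XV + wV - V ** V\<^sup>\<dagger> ** wV"
  define hP where "hP = (1/\<beta>) *\<^sub>R Dp"
  have h: "proj_formula \<alpha>1 \<gamma>1 \<beta> \<delta> (U, P, V) \<omega> = (hU, hP, hV)"
    by (simp add: \<omega> Let_def hU_def hV_def hP_def XU_def XV_def B_def Dm_def Dp_def
        del: D_minus.simps D_plus.simps)
  have Dm: "\<delta> *\<^sub>R Dm = skew_t (sV - sU)" "Dm\<^sup>\<dagger> = - Dm"
    using \<open>\<delta> > 0\<close> by (simp_all add: Dm_def \<omega> sU_def sV_def)
  have Dp_herm: "Dp\<^sup>\<dagger> = Dp"
    by (simp add: Dp_def \<omega> ktrans_inv_L_op[OF P \<open>\<beta> > 0\<close> \<open>\<delta> > 0\<close>] del: D_plus_arg.simps)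
  define Z where "Z = \<alpha>1 *\<^sub>R sU + \<gamma>1 *\<^sub>R sV"
  have arg: "D_plus_arg \<alpha>1 \<gamma>1 \<delta> (U, P, V) \<omega> = (1/\<delta>) *\<^sub>R (Z ** P - P ** Z)"
    by (simp add: \<omega> Z_def sU_def sV_def matrix_ring_simps algebra_simps)
  have L: "L_op \<beta> \<delta> P Dp = sym_t (wP + (1/\<delta>) *\<^sub>R (Z ** P - P ** Z))"
    using positive_op_bij[OF positive_op_L_op[OF P \<open>\<beta> > 0\<close> \<open>\<delta> > 0\<close>]] arg
    by (simp add: Dp_def \<omega> bij_def surj_f_inv_f del: D_plus_arg.simps)
  have B_skew: "B\<^sup>\<dagger> = - B" by (simp add: B_def herm Dp_herm algebra_simps)
  have X_skew: "XU\<^sup>\<dagger> = - XU" "XV\<^sup>\<dagger> = - XV"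
    by (simp_all add: XU_def XV_def Dm(2) B_skew)
  have Uh: "U\<^sup>\<dagger> ** hU = XU" and Vh: "V\<^sup>\<dagger> ** hV = XV"
    by (simp_all add: hU_def hV_def matrix_ring_simps UU VV)
  have tangent: "(hU, hP, hV) \<in> tangent_space (U, P, V)"
  proof -
    have "hU\<^sup>\<dagger> ** U = - XU" "hV\<^sup>\<dagger> ** V = - XV"
      using arg_cong[OF Uh, of ktrans] arg_cong[OF Vh, of ktrans] X_skew by simp_all
    then show ?thesis by (simp add: Uh Vh hP_def Dp_herm)
  qed
  have "\<alpha>1 *\<^sub>R XU + \<gamma>1 *\<^sub>R XV = \<delta> *\<^sub>R B"
    by (simp add: XU_def XV_def \<delta> algebra_simps)
  also have "\<dots> = \<beta> *\<^sub>R (?Q ** hP - hP ** ?Q)"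
    using \<open>\<delta> > 0\<close> \<open>\<beta> > 0\<close> by (simp add: B_def hP_def matrix_ring_simps algebra_simps)
  finally have horizontal: "(hU, hP, hV) \<in> horizontal_space ?g (U, P, V)"
    using tangent by (simp only: horizontal_space_iff[OF Y] Uh Vh simp_thms)
  have "inner v (?g (U, P, V) (\<omega> - (hU, hP, hV))) = 0" if "v \<in> horizontal_space ?g (U, P, V)" for v
  proof -
    obtain vU q vV where v: "v = (vU, q, vV)" by (cases v)
    define x where "x = U\<^sup>\<dagger> ** vU"
    define y where "y = V\<^sup>\<dagger> ** vV"
    define S where "S = \<alpha>1 *\<^sub>R x + \<gamma>1 *\<^sub>R y"
    from that have vt: "v \<in> tangent_space (U, P, V)" and S: "S = \<beta> *\<^sub>R (?Q ** q - q ** ?Q)"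
      by (simp_all only: v horizontal_space_iff[OF Y] S_def x_def y_def)
    then have q: "q\<^sup>\<dagger> = q" and skew: "x\<^sup>\<dagger> = - x" "y\<^sup>\<dagger> = - y"
      by (simp_all add: v x_def y_def eq_neg_iff_add_eq_0 add.commute)
    have st: "inner u (c *\<^sub>R (w - (W ** X + w - W ** W\<^sup>\<dagger> ** w))
        + (d - c) *\<^sub>R (W ** W\<^sup>\<dagger> ** (w - (W ** X + w - W ** W\<^sup>\<dagger> ** w)))) = d * inner (W\<^sup>\<dagger> ** u) (W\<^sup>\<dagger> ** w - X)"
      if W: "W\<^sup>\<dagger> ** W = mat 1" for c d X and u w W :: "'k^'p^'r::finite"
    proof -
      have proj: "W ** W\<^sup>\<dagger> ** (W ** R) = W ** R" for R :: "'k^'p^'p"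
        by (metis W matrix_mul_assoc matrix_mul_lid)
      have res: "w - (W ** X + w - W ** W\<^sup>\<dagger> ** w) = W ** (W\<^sup>\<dagger> ** w - X)"
        by (simp add: matrix_ring_simps)
      have "inner u (W ** (W\<^sup>\<dagger> ** w - X)) = inner (W\<^sup>\<dagger> ** u) (W\<^sup>\<dagger> ** w - X)"
        using inner_mult_left[of W "W\<^sup>\<dagger> ** w - X" u] by (simp add: inner_commute)
      then show ?thesis
        unfolding res proj by (simp only: inner_add_right inner_scaleR_right) (simp add: algebra_simps)
    qed
    have "inner v (?g (U, P, V) (\<omega> - (hU, hP, hV)))
      = \<alpha>1 * inner x (sU - XU) + \<gamma>1 * inner y (sV - XV) + \<beta> * inner q (?Q ** (wP - hP) ** ?Q)"
      unfolding v \<omega> diff_Pair metric_op.simps inner_Pair hU_def hV_def st[OF UU] st[OF VV]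
        x_def y_def sU_def sV_def by simp
    also have "\<alpha>1 * inner x (sU - XU) + \<gamma>1 * inner y (sV - XV) = inner S ((1/\<delta>) *\<^sub>R Z - B)"
    proof -
      have "\<delta> * inner x Dm = inner x (sV - sU)" "\<delta> * inner y Dm = inner y (sV - sU)"
        using inner_skew_t[OF skew(1), of "sV - sU"] inner_skew_t[OF skew(2), of "sV - sU"]
        by (simp_all flip: Dm(1))
      then have xy: "inner x Dm = inner x (sV - sU) / \<delta>" "inner y Dm = inner y (sV - sU) / \<delta>"
        using \<open>\<delta> > 0\<close> by (simp_all add: field_simps)
      have "\<delta> * (\<alpha>1 * inner x (sU - XU) + \<gamma>1 * inner y (sV - XV)) = \<delta> * inner S ((1/\<delta>) *\<^sub>R Z - B)"
        using \<open>\<delta> > 0\<close> unfolding XU_def XV_def S_def Z_def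
        by (simp add: inner_add_left inner_add_right inner_diff_right xy field_simps)
          (simp add: \<delta> algebra_simps)
      then show ?thesis using \<open>\<delta> > 0\<close> by simp
    qed
    also have "inner S K = \<beta> * inner q (?Q ** (K ** P - P ** K) ** ?Q)" for K
      using inner_mult_left[of ?Q q K] inner_mult_right[of q ?Q K]
      by (simp add: S inner_diff_left inner_diff_right herm matrix_ring_simps inv)
    also have "\<beta> * inner q (?Q ** (((1/\<delta>) *\<^sub>R Z - B) ** P - P ** ((1/\<delta>) *\<^sub>R Z - B)) ** ?Q)
        + \<beta> * inner q (?Q ** (wP - hP) ** ?Q)
      = \<beta> * inner (?Q ** q ** ?Q) ((wP + (1/\<delta>) *\<^sub>R (Z ** P - P ** Z)) - L_op \<beta> \<delta> P Dp)"
    proof -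
      have "L_op \<beta> \<delta> P Dp = B ** P - P ** B + hP"
        by (simp add: L_op_def B_def hP_def matrix_ring_simps inv algebra_simps scaleR_2 flip: scaleR_add_left)
      then show ?thesis
        by (simp add: inner_mult_both herm flip: distrib_left inner_add_right)
          (simp add: matrix_ring_simps algebra_simps)
    qed
    also have "\<dots> = 0"
    proof -
      have "inner (?Q ** q ** ?Q) (sym_t K) = inner (?Q ** q ** ?Q) K" for K
        by (rule inner_sym_t) (simp add: herm q matrix_mul_assoc)
      then show ?thesis by (simp add: L inner_diff_right)
    qed
    finally show ?thesis .
  qed
  then show ?thesis
    using horizontal by (simp only: is_orth_proj_def inner_E_eq_inner h) blast
qed

lemma horizontal_proj_eq_proj_formula:
  fixes U :: "'k::real_or_complex^'p::finite^'m::finite" and V :: "'k^'p^'n::finite"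
  assumes Y: "(U, P, V) \<in> manif"
    and pos: "\<alpha>0 > 0" "\<alpha>1 > 0" "\<gamma>0 > 0" "\<gamma>1 > 0" "\<beta> > 0" and \<delta>: "\<delta> = \<alpha>1 + \<gamma>1"
  defines "g \<equiv> metric_op \<alpha>0 \<alpha>1 \<gamma>0 \<gamma>1 \<beta>"
  shows "\<exists>!h. is_orth_proj (g (U, P, V)) (horizontal_space g (U, P, V)) \<omega> h"
    and "horizontal_proj g (U, P, V) \<omega> = proj_formula \<alpha>1 \<gamma>1 \<beta> \<delta> (U, P, V) \<omega>"
proof -
  note ex = is_orth_proj_proj_formula[OF Y pos(2,4,5) \<delta>, of \<alpha>0 \<gamma>0 \<omega>, folded g_def]
  note uniq = is_orth_proj_unique[OF pos_def_operator_metric_op[OF Y pos]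
      subspace_horizontal_space[of \<alpha>0 \<alpha>1 \<gamma>0 \<gamma>1 \<beta> "(U, P, V)"],
      folded g_def]
  show "\<exists>!h. is_orth_proj (g (U, P, V)) (horizontal_space g (U, P, V)) \<omega> h"
    using ex uniq by blast
  show "horizontal_proj g (U, P, V) \<omega> = proj_formula \<alpha>1 \<gamma>1 \<beta> \<delta> (U, P, V) \<omega>"
    unfolding horizontal_proj_def orth_proj_def using ex uniq by (intro the_equality) auto
qed

section \<open>The derivative of the projection\<close>

text \<open>As for the metric, the formulas are rewritten with selectors in order to differentiate them.\<close>

lemma D_minus_eq: "D_minus \<delta> Z w = (1/\<delta>) *\<^sub>R skew_t ((snd (snd Z))\<^sup>\<dagger> ** snd (snd w) - (fst Z)\<^sup>\<dagger> ** fst w)"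
  by (cases Z; cases w) simp

lemma D_plus_arg_eq:
  "D_plus_arg \<alpha>1 \<gamma>1 \<delta> Z w =
    (\<alpha>1/\<delta>) *\<^sub>R ((fst Z)\<^sup>\<dagger> ** fst w ** fst (snd Z) - fst (snd Z) ** (fst Z)\<^sup>\<dagger> ** fst w) +
    (\<gamma>1/\<delta>) *\<^sub>R ((snd (snd Z))\<^sup>\<dagger> ** snd (snd w) ** fst (snd Z) - fst (snd Z) ** (snd (snd Z))\<^sup>\<dagger> ** snd (snd w))"
  by (cases Z; cases w) simp

lemma D_plus_eq:
  "D_plus \<alpha>1 \<gamma>1 \<beta> \<delta> Z w = inv (L_op \<beta> \<delta> (fst (snd Z))) (sym_t (fst (snd w)) + sym_t (D_plus_arg \<alpha>1 \<gamma>1 \<delta> Z w))"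
  by (cases Z; cases w) (simp only: D_plus.simps linear_add[OF linear_sym_t] fst_conv snd_conv)

lemma proj_formula_eq:
  "proj_formula \<alpha>1 \<gamma>1 \<beta> \<delta> Z w =
   (let Dm = D_minus \<delta> Z w; Dp = D_plus \<alpha>1 \<gamma>1 \<beta> \<delta> Z w;
        B = (1/\<delta>) *\<^sub>R (matrix_inv (fst (snd Z)) ** Dp - Dp ** matrix_inv (fst (snd Z)))
    in (fst Z ** (- \<gamma>1 *\<^sub>R Dm + B) + fst w - fst Z ** (fst Z)\<^sup>\<dagger> ** fst w,
        (1/\<beta>) *\<^sub>R Dp,
        snd (snd Z) ** (\<alpha>1 *\<^sub>R Dm + B) + snd (snd w) - snd (snd Z) ** (snd (snd Z))\<^sup>\<dagger> ** snd (snd w)))"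
  by (cases Z; cases w) (simp only: proj_formula.simps Let_def fst_conv snd_conv)

lemmas bounded_linear_sym_t = linear_conv_bounded_linear[THEN iffD1, OF linear_sym_t]
lemmas bounded_linear_skew_t = linear_conv_bounded_linear[THEN iffD1, OF linear_skew_t]

lemma has_derivative_D_minus:
  fixes Y :: "('k::real_or_complex, 'm::finite, 'n::finite, 'p::finite) ambient"
  shows "((\<lambda>Z. D_minus \<delta> Z w) has_derivative (\<lambda>v. D_minus \<delta> v w)) (at Y)"
  unfolding D_minus_eq
  by (rule has_derivative_eq_rhs, (rule matrix_derivative_intros bounded_linear.has_derivative[OF bounded_linear_skew_t])+)
    (simp add: fun_eq_iff mm.zero_right)

lemma differentiable_sym_t_D_plus_arg:
  fixes Y :: "('k::real_or_complex, 'm::finite, 'n::finite, 'p::finite) ambient"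
  shows "(\<lambda>Z. sym_t (D_plus_arg \<alpha>1 \<gamma>1 \<delta> Z w)) differentiable (at Y)"
  unfolding D_plus_arg_eq differentiable_def
  by (rule exI, (rule matrix_derivative_intros bounded_linear.has_derivative[OF bounded_linear_sym_t])+)

lemma has_derivative_L_op:
  fixes f :: "'a::real_normed_vector \<Rightarrow> 'k::real_or_complex^'p::finite^'p"
  assumes f: "(f has_derivative f') (at y)" and inv: "invertible (f y)"
  defines "P \<equiv> f y" and "Q \<equiv> matrix_inv (f y)"
  shows "((\<lambda>z. L_op \<beta> \<delta> (f z) X) has_derivative
    (\<lambda>v. (1/\<delta>) *\<^sub>R (f' v ** X ** Q + Q ** X ** f' v - P ** X ** Q ** f' v ** Q - Q ** f' v ** Q ** X ** P))) (at y)"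
  unfolding L_op_def
  by (rule has_derivative_eq_rhs, (rule matrix_derivative_intros f inv)+)
    (simp add: fun_eq_iff P_def Q_def matrix_ring_simps algebra_simps)

text \<open>
  \<open>D_plus\<close> solves a linear system with operator \<open>L_op \<beta> \<delta> P\<close>. The subtracted term is the derivative of
  the operator, applied to the solution. Since \<open>L_op\<close> remains bijective near \<open>P\<close>, for matrices that
  are not Hermitian too, the derivative exists in all ambient directions.
\<close>

lemma has_derivative_D_plus:
  fixes U :: "'k::real_or_complex^'p::finite^'m::finite" and V :: "'k^'p^'n::finite" and P :: "'k^'p^'p"
    and w :: "('k, 'm, 'n, 'p) ambient" and \<alpha>1 \<gamma>1 \<beta> \<delta> :: real
  assumes P: "P \<in> pos_def_matrices" and "\<beta> > 0" "\<delta> > 0"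
  defines "Q \<equiv> matrix_inv P" and "Dp \<equiv> D_plus \<alpha>1 \<gamma>1 \<beta> \<delta> (U, P, V) w"
  shows "((\<lambda>Z. D_plus \<alpha>1 \<gamma>1 \<beta> \<delta> Z w) has_derivative
    (\<lambda>(vU, vP, vV). inv (L_op \<beta> \<delta> P)
       (dirderiv (\<lambda>Z. sym_t (D_plus_arg \<alpha>1 \<gamma>1 \<delta> Z w)) (U, P, V) (vU, vP, vV)
        - (1/\<delta>) *\<^sub>R (vP ** Dp ** Q + Q ** Dp ** vP - P ** Dp ** Q ** vP ** Q - Q ** vP ** Q ** Dp ** P))))
    (at (U, P, V))"
proof -
  let ?Y = "(U, P, V)" and ?S = "\<lambda>Z. sym_t (D_plus_arg \<alpha>1 \<gamma>1 \<delta> Z w)"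
  have S: "(?S has_derivative dirderiv ?S ?Y) (at ?Y)"
    using differentiable_sym_t_D_plus_arg unfolding dirderiv_def by (simp only: frechet_derivative_works eta_contract_eq)
  have "((\<lambda>Z. sym_t (fst (snd w)) + ?S Z) has_derivative (\<lambda>v. 0 + dirderiv ?S ?Y v)) (at ?Y)"
    by (intro has_derivative_add has_derivative_const S)
  moreover have "((\<lambda>Z. fst (snd Z)) has_derivative (\<lambda>v. fst (snd v))) (at ?Y)"
    by (intro has_derivative_fst has_derivative_snd has_derivative_ident)
  note L' = has_derivative_L_op[OF this, unfolded fst_conv snd_conv, OF pos_def_invertible[OF P], of \<beta> \<delta>, folded Q_def]
  ultimately show ?thesis
    unfolding D_plus_eq
    using has_derivative_linear_system[OF linear_L_op L', unfolded fst_conv snd_conv,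
        OF positive_op_bij[OF positive_op_L_op[OF P \<open>\<beta> > 0\<close> \<open>\<delta> > 0\<close>]]]
    by (simp add: Dp_def D_plus_eq case_prod_unfold)
qed

lemma has_derivative_proj_formula:
  fixes U wU :: "'k::real_or_complex^'p::finite^'m::finite" and V wV :: "'k^'p^'n::finite"
    and P wP :: "'k^'p^'p" and \<alpha>1 \<gamma>1 \<beta> \<delta> :: real and Dp'
  assumes P: "P \<in> pos_def_matrices" and Y: "Y = (U, P, V)"
    and Dp': "((\<lambda>Z. D_plus \<alpha>1 \<gamma>1 \<beta> \<delta> Z (wU, wP, wV)) has_derivative Dp') (at Y)"
  defines "Q \<equiv> matrix_inv P" and "Dm \<equiv> D_minus \<delta> Y (wU, wP, wV)" and "Dm' \<equiv> \<lambda>v. D_minus \<delta> v (wU, wP, wV)"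
    and "Dp \<equiv> D_plus \<alpha>1 \<gamma>1 \<beta> \<delta> Y (wU, wP, wV)"
  defines "B \<equiv> (1/\<delta>) *\<^sub>R (Q ** Dp - Dp ** Q)"
    and "B' \<equiv> \<lambda>v. (1/\<delta>) *\<^sub>R (- (Q ** fst (snd v) ** Q ** Dp) + Q ** Dp' v - Dp' v ** Q + Dp ** Q ** fst (snd v) ** Q)"
  shows "((\<lambda>Z. proj_formula \<alpha>1 \<gamma>1 \<beta> \<delta> Z (wU, wP, wV)) has_derivative
    (\<lambda>v. (fst v ** (- \<gamma>1 *\<^sub>R Dm + B) + U ** (- \<gamma>1 *\<^sub>R Dm' v + B' v)
            - fst v ** U\<^sup>\<dagger> ** wU - U ** (fst v)\<^sup>\<dagger> ** wU,
          (1/\<beta>) *\<^sub>R Dp' v,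
          snd (snd v) ** (\<alpha>1 *\<^sub>R Dm + B) + V ** (\<alpha>1 *\<^sub>R Dm' v + B' v)
            - snd (snd v) ** V\<^sup>\<dagger> ** wV - V ** (snd (snd v))\<^sup>\<dagger> ** wV))) (at Y)"
proof -
  have Y_sel: "fst Y = U" "fst (snd Y) = P" "snd (snd Y) = V" by (simp_all add: Y)
  have inv: "invertible (fst (snd Y))" using pos_def_invertible[OF P] by (simp add: Y)
  show ?thesis
    unfolding proj_formula_eq Let_def
    by (rule has_derivative_eq_rhs, (rule matrix_derivative_intros has_derivative_D_minus Dp' inv)+, rule ext)
      (simp add: Q_def Dm_def Dm'_def Dp_def B_def B'_def Y_sel matrix_ring_simps algebra_simps)
qed

theorem proposition1:
  fixes \<alpha>0 \<alpha>1 \<gamma>0 \<gamma>1 \<beta> \<delta> :: real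
    and M :: "('k::real_or_complex, 'm::finite, 'n::finite, 'p::finite) ambient set"
    and g :: "('k, 'm, 'n, 'p) ambient \<Rightarrow> ('k, 'm, 'n, 'p) ambient \<Rightarrow> ('k, 'm, 'n, 'p) ambient"
  assumes "CARD('p) \<le> min CARD('m) CARD('n)"
    and "\<alpha>0 > 0" "\<alpha>1 > 0" "\<gamma>0 > 0" "\<gamma>1 > 0" "\<beta> > 0"
    and "\<delta> = \<alpha>1 + \<gamma>1"
    and "M = manif"
    and "g = metric_op \<alpha>0 \<alpha>1 \<gamma>0 \<gamma>1 \<beta>"
  shows
    "((\<forall>Y\<in>M. pos_def_operator (g Y) \<and> inner_product_on UNIV (\<lambda>w w'. inner_E w (g Y w'))) \<and>
      riemannian_metric_on M tangent_space (\<lambda>Y w w'. inner_E w (g Y w')))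
   \<and> (\<forall>U P V \<omega>. (U, P, V) \<in> M \<longrightarrow>
        bij (L_op \<beta> \<delta> P) \<and>
        (\<exists>!h. is_orth_proj (g (U, P, V)) (horizontal_space g (U, P, V)) \<omega> h) \<and>
        horizontal_proj g (U, P, V) \<omega> = proj_formula \<alpha>1 \<gamma>1 \<beta> \<delta> (U, P, V) \<omega>)
   \<and> (\<forall>U P V \<xi>U \<xi>P \<xi>V \<eta>U \<eta>P \<eta>V. (U, P, V) \<in> M \<longrightarrow>
        (\<xi>U, \<xi>P, \<xi>V) \<in> tangent_space (U, P, V) \<longrightarrow> (\<eta>U, \<eta>P, \<eta>V) \<in> tangent_space (U, P, V) \<longrightarrow>
        (\<forall>\<omega>. (\<lambda>Z. g Z \<omega>) differentiable (at (U, P, V))) \<and>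
        (\<exists>!x. is_cross_term g (U, P, V) (\<eta>U, \<eta>P, \<eta>V) (\<xi>U, \<xi>P, \<xi>V) x) \<and>
        christoffel g (U, P, V) (\<eta>U, \<eta>P, \<eta>V) (\<xi>U, \<xi>P, \<xi>V) =
          ((\<alpha>1 - \<alpha>0) *\<^sub>R (U ** sym_t (\<eta>U\<^sup>\<dagger> ** \<xi>U) - (\<eta>U ** \<xi>U\<^sup>\<dagger> + \<xi>U ** \<eta>U\<^sup>\<dagger>) ** U),
           - \<beta> *\<^sub>R sym_t (matrix_inv P ** \<eta>P ** matrix_inv P ** \<xi>P ** matrix_inv P),
           (\<gamma>1 - \<gamma>0) *\<^sub>R (V ** sym_t (\<eta>V\<^sup>\<dagger> ** \<xi>V) - (\<eta>V ** \<xi>V\<^sup>\<dagger> + \<xi>V ** \<eta>V\<^sup>\<dagger>) ** V)))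
   \<and> (\<forall>U P V \<xi>U \<xi>P \<xi>V \<omega>U \<omega>P \<omega>V. (U, P, V) \<in> M \<longrightarrow>
        (\<xi>U, \<xi>P, \<xi>V) \<in> tangent_space (U, P, V) \<longrightarrow>
        (let Y = (U, P, V); \<xi> = (\<xi>U, \<xi>P, \<xi>V); \<omega> = (\<omega>U, \<omega>P, \<omega>V);
             Pi = matrix_inv P;
             SF = (\<lambda>Z. sym_t (D_plus_arg \<alpha>1 \<gamma>1 \<delta> Z \<omega>));
             DmF = (\<lambda>Z. D_minus \<delta> Z \<omega>);
             DpF = (\<lambda>Z. D_plus \<alpha>1 \<gamma>1 \<beta> \<delta> Z \<omega>);
             PF = (\<lambda>Z. proj_formula \<alpha>1 \<gamma>1 \<beta> \<delta> Z \<omega>);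
             Dm = DmF Y; Dp = DpF Y; Dm' = dirderiv DmF Y \<xi>; Dp' = dirderiv DpF Y \<xi>;
             B = (1/\<delta>) *\<^sub>R (Pi ** Dp - Dp ** Pi);
             B' = (1/\<delta>) *\<^sub>R (- (Pi ** \<xi>P ** Pi ** Dp) + Pi ** Dp'
                           - Dp' ** Pi + Dp ** Pi ** \<xi>P ** Pi)
         in SF differentiable (at Y) \<and> DmF differentiable (at Y) \<and>
            DpF differentiable (at Y) \<and> PF differentiable (at Y) \<and>
            ((\<lambda>Z. horizontal_proj g Z \<omega>) has_derivative dirderiv PF Y) (at Y within M) \<and>
            Dm' = (1/\<delta>) *\<^sub>R skew_t (\<xi>V\<^sup>\<dagger> ** \<omega>V - \<xi>U\<^sup>\<dagger> ** \<omega>U) \<and>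
            Dp' = inv (L_op \<beta> \<delta> P)
                    (dirderiv SF Y \<xi>
                     - (1/\<delta>) *\<^sub>R (\<xi>P ** Dp ** Pi + Pi ** Dp ** \<xi>P
                                  - P ** Dp ** Pi ** \<xi>P ** Pi - Pi ** \<xi>P ** Pi ** Dp ** P)) \<and>
            dirderiv PF Y \<xi> =
              (\<xi>U ** (- \<gamma>1 *\<^sub>R Dm + B) + U ** (- \<gamma>1 *\<^sub>R Dm' + B')
                 - \<xi>U ** U\<^sup>\<dagger> ** \<omega>U - U ** \<xi>U\<^sup>\<dagger> ** \<omega>U,
               (1/\<beta>) *\<^sub>R Dp',
               \<xi>V ** (\<alpha>1 *\<^sub>R Dm + B) + V ** (\<alpha>1 *\<^sub>R Dm' + B')
                 - \<xi>V ** V\<^sup>\<dagger> ** \<omega>V - V ** \<xi>V\<^sup>\<dagger> ** \<omega>V)))"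
proof (intro conjI)
  have pos: "\<alpha>0 > 0" "\<alpha>1 > 0" "\<gamma>0 > 0" "\<gamma>1 > 0" "\<beta> > 0" and \<delta>: "\<delta> = \<alpha>1 + \<gamma>1" and "\<delta> > 0"
    and M: "M = manif" and g: "g = metric_op \<alpha>0 \<alpha>1 \<gamma>0 \<gamma>1 \<beta>"
    using assms by auto
  have PD: "P \<in> pos_def_matrices" if "(U, P, V) \<in> M" for U P V
    using that by (auto simp: M manif_def)
  have proj: "\<exists>!h. is_orth_proj (g (U, P, V)) (horizontal_space g (U, P, V)) \<omega> h"
    "horizontal_proj g (U, P, V) \<omega> = proj_formula \<alpha>1 \<gamma>1 \<beta> \<delta> (U, P, V) \<omega>"
    if "(U, P, V) \<in> M" for U P V \<omega>
    using horizontal_proj_eq_proj_formula[OF _ pos \<delta>] that unfolding M g by blast+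
  show "\<forall>Y\<in>M. pos_def_operator (g Y) \<and> inner_product_on UNIV (\<lambda>w w'. inner_E w (g Y w'))"
    unfolding M g
    by (intro ballI conjI inner_product_on_pos_def_operator subspace_UNIV pos_def_operator_metric_op pos)
  show "riemannian_metric_on M tangent_space (\<lambda>Y w w'. inner_E w (g Y w'))"
    using riemannian_metric_on_metric_op[OF pos] by (simp add: M g)
  show "\<forall>U P V \<omega>. (U, P, V) \<in> M \<longrightarrow>
        bij (L_op \<beta> \<delta> P) \<and>
        (\<exists>!h. is_orth_proj (g (U, P, V)) (horizontal_space g (U, P, V)) \<omega> h) \<and>
        horizontal_proj g (U, P, V) \<omega> = proj_formula \<alpha>1 \<gamma>1 \<beta> \<delta> (U, P, V) \<omega>"
    using proj positive_op_bij[OF positive_op_L_op[OF PD \<open>\<beta> > 0\<close> \<open>\<delta> > 0\<close>]] by blast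
  show "\<forall>U P V \<xi>U \<xi>P \<xi>V \<eta>U \<eta>P \<eta>V. (U, P, V) \<in> M \<longrightarrow>
        (\<xi>U, \<xi>P, \<xi>V) \<in> tangent_space (U, P, V) \<longrightarrow> (\<eta>U, \<eta>P, \<eta>V) \<in> tangent_space (U, P, V) \<longrightarrow>
        (\<forall>\<omega>. (\<lambda>Z. g Z \<omega>) differentiable (at (U, P, V))) \<and>
        (\<exists>!x. is_cross_term g (U, P, V) (\<eta>U, \<eta>P, \<eta>V) (\<xi>U, \<xi>P, \<xi>V) x) \<and>
        christoffel g (U, P, V) (\<eta>U, \<eta>P, \<eta>V) (\<xi>U, \<xi>P, \<xi>V) =
          ((\<alpha>1 - \<alpha>0) *\<^sub>R (U ** sym_t (\<eta>U\<^sup>\<dagger> ** \<xi>U) - (\<eta>U ** \<xi>U\<^sup>\<dagger> + \<xi>U ** \<eta>U\<^sup>\<dagger>) ** U),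
           - \<beta> *\<^sub>R sym_t (matrix_inv P ** \<eta>P ** matrix_inv P ** \<xi>P ** matrix_inv P),
           (\<gamma>1 - \<gamma>0) *\<^sub>R (V ** sym_t (\<eta>V\<^sup>\<dagger> ** \<xi>V) - (\<eta>V ** \<xi>V\<^sup>\<dagger> + \<xi>V ** \<eta>V\<^sup>\<dagger>) ** V))"
  proof (intro allI impI conjI)
    fix U P V \<xi>U \<xi>P \<xi>V \<eta>U \<eta>P \<eta>V
    assume Y: "(U, P, V) \<in> M" and \<xi>: "(\<xi>U, \<xi>P, \<xi>V) \<in> tangent_space (U, P, V)"
      and \<eta>: "(\<eta>U, \<eta>P, \<eta>V) \<in> tangent_space (U, P, V)"
    show "(\<lambda>Z. g Z \<omega>) differentiable (at (U, P, V))" for \<omega>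
    proof -
      obtain wU wP wV where \<omega>: "\<omega> = (wU, wP, wV)" by (cases \<omega>)
      show ?thesis
        unfolding g \<omega> differentiable_def
        by (rule exI, rule has_derivative_metric_op[OF refl pos_def_invertible[OF PD[OF Y]]])
    qed
    have herm: "\<eta>P\<^sup>\<dagger> = \<eta>P" "\<xi>P\<^sup>\<dagger> = \<xi>P" using \<xi> \<eta> by auto
    show "\<exists>!x. is_cross_term g (U, P, V) (\<eta>U, \<eta>P, \<eta>V) (\<xi>U, \<xi>P, \<xi>V) x"
      unfolding g
      by (rule ex1I, rule is_cross_term_metric_op[OF PD[OF Y] herm],
          erule is_cross_term_unique[OF _ is_cross_term_metric_op[OF PD[OF Y] herm]])
  qed (use christoffel_metric_op M g in blast)
  show "\<forall>U P V \<xi>U \<xi>P \<xi>V \<omega>U \<omega>P \<omega>V. (U, P, V) \<in> M \<longrightarrow>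
        (\<xi>U, \<xi>P, \<xi>V) \<in> tangent_space (U, P, V) \<longrightarrow>
        (let Y = (U, P, V); \<xi> = (\<xi>U, \<xi>P, \<xi>V); \<omega> = (\<omega>U, \<omega>P, \<omega>V);
             Pi = matrix_inv P;
             SF = (\<lambda>Z. sym_t (D_plus_arg \<alpha>1 \<gamma>1 \<delta> Z \<omega>));
             DmF = (\<lambda>Z. D_minus \<delta> Z \<omega>);
             DpF = (\<lambda>Z. D_plus \<alpha>1 \<gamma>1 \<beta> \<delta> Z \<omega>);
             PF = (\<lambda>Z. proj_formula \<alpha>1 \<gamma>1 \<beta> \<delta> Z \<omega>);
             Dm = DmF Y; Dp = DpF Y; Dm' = dirderiv DmF Y \<xi>; Dp' = dirderiv DpF Y \<xi>;
             B = (1/\<delta>) *\<^sub>R (Pi ** Dp - Dp ** Pi);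
             B' = (1/\<delta>) *\<^sub>R (- (Pi ** \<xi>P ** Pi ** Dp) + Pi ** Dp'
                           - Dp' ** Pi + Dp ** Pi ** \<xi>P ** Pi)
         in SF differentiable (at Y) \<and> DmF differentiable (at Y) \<and>
            DpF differentiable (at Y) \<and> PF differentiable (at Y) \<and>
            ((\<lambda>Z. horizontal_proj g Z \<omega>) has_derivative dirderiv PF Y) (at Y within M) \<and>
            Dm' = (1/\<delta>) *\<^sub>R skew_t (\<xi>V\<^sup>\<dagger> ** \<omega>V - \<xi>U\<^sup>\<dagger> ** \<omega>U) \<and>
            Dp' = inv (L_op \<beta> \<delta> P)
                    (dirderiv SF Y \<xi>
                     - (1/\<delta>) *\<^sub>R (\<xi>P ** Dp ** Pi + Pi ** Dp ** \<xi>P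
                                  - P ** Dp ** Pi ** \<xi>P ** Pi - Pi ** \<xi>P ** Pi ** Dp ** P)) \<and>
            dirderiv PF Y \<xi> =
              (\<xi>U ** (- \<gamma>1 *\<^sub>R Dm + B) + U ** (- \<gamma>1 *\<^sub>R Dm' + B')
                 - \<xi>U ** U\<^sup>\<dagger> ** \<omega>U - U ** \<xi>U\<^sup>\<dagger> ** \<omega>U,
               (1/\<beta>) *\<^sub>R Dp',
               \<xi>V ** (\<alpha>1 *\<^sub>R Dm + B) + V ** (\<alpha>1 *\<^sub>R Dm' + B')
                 - \<xi>V ** V\<^sup>\<dagger> ** \<omega>V - V ** \<xi>V\<^sup>\<dagger> ** \<omega>V))"
  proof (intro allI impI, goal_cases)
    case (1 U P V \<xi>U \<xi>P \<xi>V \<omega>U \<omega>P \<omega>V)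
    let ?Y = "(U, P, V)" and ?\<omega> = "(\<omega>U, \<omega>P, \<omega>V)"
    note Dm' = has_derivative_D_minus[of \<delta> ?\<omega> ?Y]
    note Dp' = has_derivative_D_plus[OF PD[OF 1(1)] \<open>\<beta> > 0\<close> \<open>\<delta> > 0\<close>, of \<alpha>1 \<gamma>1 ?\<omega> U V]
    note PF' = has_derivative_proj_formula[OF PD[OF 1(1)] refl Dp']
    \<comment> \<open>The projection agrees with the formula only on \<open>M\<close>, hence the derivative within \<open>M\<close>.\<close>
    have hp: "((\<lambda>Z. horizontal_proj g Z ?\<omega>) has_derivative
        dirderiv (\<lambda>Z. proj_formula \<alpha>1 \<gamma>1 \<beta> \<delta> Z ?\<omega>) ?Y) (at ?Y within M)"
    proof (rule has_derivative_transform[OF 1(1)])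
      show "horizontal_proj g Z ?\<omega> = proj_formula \<alpha>1 \<gamma>1 \<beta> \<delta> Z ?\<omega>" if "Z \<in> M" for Z
        using proj(2) that by (cases Z) blast
      show "((\<lambda>Z. proj_formula \<alpha>1 \<gamma>1 \<beta> \<delta> Z ?\<omega>) has_derivative
        dirderiv (\<lambda>Z. proj_formula \<alpha>1 \<gamma>1 \<beta> \<delta> Z ?\<omega>) ?Y) (at ?Y within M)"
        using PF' unfolding dirderiv_def frechet_derivative_at[OF PF', symmetric]
        by (rule has_derivative_at_withinI)
    qed
    show ?case
      unfolding Let_def
    proof (intro conjI hp)
      show "(\<lambda>Z. sym_t (D_plus_arg \<alpha>1 \<gamma>1 \<delta> Z ?\<omega>)) differentiable (at ?Y)"
        by (rule differentiable_sym_t_D_plus_arg)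
      show "(\<lambda>Z. D_minus \<delta> Z ?\<omega>) differentiable (at ?Y)"
        "(\<lambda>Z. D_plus \<alpha>1 \<gamma>1 \<beta> \<delta> Z ?\<omega>) differentiable (at ?Y)"
        "(\<lambda>Z. proj_formula \<alpha>1 \<gamma>1 \<beta> \<delta> Z ?\<omega>) differentiable (at ?Y)"
        using Dm' Dp' PF' differentiableI by blast+
    qed (simp_all only: dirderiv_def[of "\<lambda>Z. D_minus \<delta> Z ?\<omega>"] dirderiv_def[of "\<lambda>Z. D_plus \<alpha>1 \<gamma>1 \<beta> \<delta> Z ?\<omega>"]
        dirderiv_def[of "\<lambda>Z. proj_formula \<alpha>1 \<gamma>1 \<beta> \<delta> Z ?\<omega>"] frechet_derivative_at[OF Dm', symmetric]
        frechet_derivative_at[OF Dp', symmetric] frechet_derivative_at[OF PF', symmetric]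
        D_minus.simps prod.case fst_conv snd_conv)
  qed
qed

end
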